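(* Every nilpotently vertex-transitive graph of valency at least four admits a nowhere-zero $3$-flow.
   Context: All graphs are finite and undirected; parallel edges are allowed, and vertex-transitive graphs are assumed to have no loops. An automorphism of a graph $G$ is a bijection of $V(G)\cup E(G)$ mapping $V(G)$ onto $V(G)$ and $E(G)$ onto $E(G)$ that preserves incidence; these form the group $\mathrm{Aut}(G)$. A graph is nilpotently vertex-transitive if $\mathrm{Aut}(G)$ contains a nilpotent subgroup acting transitively on $V(G)$. For an orientation $D$ of $G$ and integer-valued $\varphi$ on $E(G)$, write $\varphi^{+}(v)$ (resp. $\varphi^-(v)$) for the sum of $\varphi(e)$ over edges $e$ with tail (resp. head) $v$. A nowhere-zero $k$-flow is a pair $(D,\varphi)$ with $0<|\varphi(e)|<k$ for all edges $e$ and $\varphi^+(v)=\varphi^-(v)$ for all vertices $v$; $G$ admits a nowhere-zero $k$-flow if such a pair exists for some orientation. *)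

theory Defs
  imports
    "HOL-Algebra.Generated_Groups"
    "HOL-Algebra.Bij"
    "Graph_Theory.Digraph"
begin

section \<open>Finite undirected multigraphs\<close>

record ('v, 'e) multigraph =
  vertices :: "'v set"
  edges :: "'e set"
  ends :: "'e \<Rightarrow> 'v set"

text \<open>Distinct edges may have the same set of ends; an edge with a single end is a loop.\<close>

locale finite_multigraph =
  fixes G :: "('v, 'e) multigraph" (structure)
  assumes finite_vertices: "finite (vertices G)"
    and finite_edges: "finite (edges G)"
    and ends_subset: "e \<in> edges G \<Longrightarrow> ends G e \<subseteq> vertices G"
    and card_ends: "e \<in> edges G \<Longrightarrow> card (ends G e) \<in> {1, 2}"

definition loopless :: "('v, 'e) multigraph \<Rightarrow> bool" where
  "loopless G \<longleftrightarrow> (\<forall>e\<in>edges G. card (ends G e) \<noteq> 1)"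

text \<open>Edges are counted with multiplicity, and a loop counts twice.\<close>

definition valency_at :: "('v, 'e) multigraph \<Rightarrow> 'v \<Rightarrow> nat" where
  "valency_at G v = card {e \<in> edges G. v \<in> ends G e} + card {e \<in> edges G. ends G e = {v}}"

definition has_valency :: "('v, 'e) multigraph \<Rightarrow> nat \<Rightarrow> bool" where
  "has_valency G d \<longleftrightarrow> (\<forall>v\<in>vertices G. valency_at G v = d)"


section \<open>Automorphisms\<close>

text \<open>An automorphism permutes the disjoint union of the vertex set and the edge set, so that
  it is determined by its action on vertices and edges together; in particular, parallel edges
  can be permuted while every vertex is fixed.\<close>

definition automorphisms :: "('v, 'e) multigraph \<Rightarrow> ('v + 'e \<Rightarrow> 'v + 'e) set" where
  "automorphisms G = {f \<in> Bij (vertices G <+> edges G).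
     f ` Inl ` vertices G = Inl ` vertices G \<and>
     f ` Inr ` edges G = Inr ` edges G \<and>
     (\<forall>v\<in>vertices G. \<forall>e\<in>edges G. \<forall>v' e'.
        f (Inl v) = Inl v' \<longrightarrow> f (Inr e) = Inr e' \<longrightarrow> (v \<in> ends G e \<longleftrightarrow> v' \<in> ends G e'))}"

definition Aut :: "('v, 'e) multigraph \<Rightarrow> ('v + 'e \<Rightarrow> 'v + 'e) monoid" where
  "Aut G = (BijGroup (vertices G <+> edges G))\<lparr>carrier := automorphisms G\<rparr>"

lemma subgroup_automorphisms:
  "subgroup (automorphisms G) (BijGroup (vertices G <+> edges G))"
proof -
  let ?V = "vertices G" and ?E = "edges G"
  let ?S = "?V <+> ?E"
  interpret B: group "BijGroup ?S" by (rule group_BijGroup)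
  have one: "(\<lambda>x\<in>?S. x) \<in> automorphisms G"
    unfolding automorphisms_def
    by (auto simp: id_Bij image_image)
  have comp: "compose ?S g f \<in> automorphisms G"
    if f: "f \<in> automorphisms G" and g: "g \<in> automorphisms G" for f g
  proof -
    have V: "compose ?S g f ` Inl ` ?V = g ` f ` Inl ` ?V"
      unfolding image_image by (rule image_cong) (auto simp: compose_def)
    have E: "compose ?S g f ` Inr ` ?E = g ` f ` Inr ` ?E"
      unfolding image_image by (rule image_cong) (auto simp: compose_def)
    have "v \<in> ends G e \<longleftrightarrow> v' \<in> ends G e'"
      if v: "v \<in> ?V" "e \<in> ?E" "compose ?S g f (Inl v) = Inl v'" "compose ?S g f (Inr e) = Inr e'"
      for v e v' e'
    proof -
      have "f (Inl v) \<in> Inl ` ?V" "f (Inr e) \<in> Inr ` ?E"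
        using f v(1,2) unfolding automorphisms_def by blast+
      then obtain v1 e1 where 1: "f (Inl v) = Inl v1" "v1 \<in> ?V" "f (Inr e) = Inr e1" "e1 \<in> ?E"
        by blast
      have "g (Inl v1) = Inl v'" "g (Inr e1) = Inr e'"
        using v 1 by (auto simp: compose_def InlI InrI)
      then show ?thesis using f g v(1,2) 1 unfolding automorphisms_def by blast
    qed
    then show ?thesis
      using f g V E unfolding automorphisms_def by (auto simp: compose_Bij)
  qed
  have inverse: "h \<in> automorphisms G"
    if f: "f \<in> automorphisms G" and h: "h = restrict (inv_into ?S f) ?S" for f h
  proof -
    have fB: "f \<in> Bij ?S" using f by (simp add: automorphisms_def)
    then have inj: "inj_on f ?S" by (simp add: Bij_def bij_betw_def)
    have hf: "h (f x) = x" if "x \<in> ?S" for x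
      using inj that fB h by (auto simp: Bij_def bij_betw_def)
    have img: "h ` f ` A = A" if "A \<subseteq> ?S" for A
      using hf that by (force simp: image_image)
    have "Inl ` ?V \<subseteq> ?S" "Inr ` ?E \<subseteq> ?S" by auto
    then have VE: "h ` Inl ` ?V = Inl ` ?V" "h ` Inr ` ?E = Inr ` ?E"
      using img f unfolding automorphisms_def by (metis (mono_tags, lifting) mem_Collect_eq)+
    have "v \<in> ends G e \<longleftrightarrow> v' \<in> ends G e'"
      if v: "v \<in> ?V" "e \<in> ?E" "h (Inl v) = Inl v'" "h (Inr e) = Inr e'" for v e v' e'
    proof -
      have "Inl v \<in> f ` Inl ` ?V" "Inr e \<in> f ` Inr ` ?E"
        using f v(1,2) unfolding automorphisms_def by blast+
      then obtain v1 e1 where 1: "Inl v = f (Inl v1)" "v1 \<in> ?V" "Inr e = f (Inr e1)" "e1 \<in> ?E"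
        by blast
      have "v1 = v'" "e1 = e'" using v 1 hf[of "Inl v1"] hf[of "Inr e1"] by auto
      then show ?thesis using f v(1,2) 1 unfolding automorphisms_def by force
    qed
    then show ?thesis
      using VE h restrict_inv_into_Bij[OF fB] unfolding automorphisms_def by blast
  qed
  show ?thesis
  proof (rule B.subgroupI)
    show "automorphisms G \<subseteq> carrier (BijGroup ?S)"
      by (auto simp: automorphisms_def BijGroup_def)
    show "automorphisms G \<noteq> {}" using one by blast
    fix f assume f: "f \<in> automorphisms G"
    then have "f \<in> Bij ?S" by (simp add: automorphisms_def)
    then show "inv\<^bsub>BijGroup ?S\<^esub> f \<in> automorphisms G"
      using inverse[OF f refl] by (simp add: inv_BijGroup)
    fix g assume g: "g \<in> automorphisms G"
    then have "g \<in> Bij ?S" by (simp add: automorphisms_def)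
    then show "f \<otimes>\<^bsub>BijGroup ?S\<^esub> g \<in> automorphisms G"
      using comp[OF g f] \<open>f \<in> Bij ?S\<close> by (simp add: BijGroup_def)
  qed
qed

lemma group_Aut: "group (Aut G)"
  unfolding Aut_def
  by (rule group.subgroup_imp_group[OF group_BijGroup subgroup_automorphisms])


section \<open>Nilpotent groups and nilpotent vertex-transitivity\<close>

primrec lower_central_series :: "('a, 'b) monoid_scheme \<Rightarrow> nat \<Rightarrow> 'a set" where
  "lower_central_series K 0 = carrier K"
| "lower_central_series K (Suc n) = generate K
     (\<Union>x\<in>lower_central_series K n. \<Union>y\<in>carrier K.
        {x \<otimes>\<^bsub>K\<^esub> y \<otimes>\<^bsub>K\<^esub> inv\<^bsub>K\<^esub> x \<otimes>\<^bsub>K\<^esub> inv\<^bsub>K\<^esub> y})"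

locale nilpotent_group = group K for K (structure) +
  assumes nilpotent: "\<exists>n. lower_central_series K n = {\<one>}"

definition transitive_on_vertices ::
    "('v, 'e) multigraph \<Rightarrow> ('v + 'e \<Rightarrow> 'v + 'e) set \<Rightarrow> bool" where
  "transitive_on_vertices G H \<longleftrightarrow>
     (\<forall>u\<in>vertices G. \<forall>v\<in>vertices G. \<exists>f\<in>H. f (Inl u) = Inl v)"

text \<open>By convention, vertex-transitive graphs have no loops.\<close>

definition nilpotently_vertex_transitive :: "('v, 'e) multigraph \<Rightarrow> bool" where
  "nilpotently_vertex_transitive G \<longleftrightarrow> loopless G \<and>
     (\<exists>H. subgroup H (Aut G) \<and> nilpotent_group ((Aut G)\<lparr>carrier := H\<rparr>) \<and>
          transitive_on_vertices G H)"


section \<open>Nowhere-zero flows\<close>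

definition orientation :: "('v, 'e) multigraph \<Rightarrow> ('v, 'e) pre_digraph \<Rightarrow> bool" where
  "orientation G D \<longleftrightarrow> verts D = vertices G \<and> arcs D = edges G \<and>
     (\<forall>e\<in>edges G. ends G e = {tail D e, head D e})"

definition nowhere_zero_flow ::
    "('v, 'e) multigraph \<Rightarrow> nat \<Rightarrow> ('v, 'e) pre_digraph \<Rightarrow> ('e \<Rightarrow> int) \<Rightarrow> bool" where
  "nowhere_zero_flow G k D \<phi> \<longleftrightarrow> orientation G D \<and>
     (\<forall>e\<in>edges G. 0 < \<bar>\<phi> e\<bar> \<and> \<bar>\<phi> e\<bar> < int k) \<and>
     (\<forall>v\<in>vertices G. (\<Sum>e\<in>out_arcs D v. \<phi> e) = (\<Sum>e\<in>in_arcs D v. \<phi> e))"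

definition admits_nowhere_zero_flow :: "('v, 'e) multigraph \<Rightarrow> nat \<Rightarrow> bool" where
  "admits_nowhere_zero_flow G k \<longleftrightarrow> (\<exists>D \<phi>. nowhere_zero_flow G k D \<phi>)"

end

theory Submission
  imports Defs "HOL-Algebra.Group_Action" "HOL-Algebra.Sylow"
begin

text \<open>If the valency \<open>d\<close> is even, any orientation is a flow modulo 2, which lifts to an integral
  nowhere-zero 2-flow. If \<open>d\<close> is odd, it suffices to find a nowhere-zero flow modulo 3. As \<open>c \<ge> 2\<close>
  parallel edges with values \<open>\<plusminus>1\<close> can carry any total modulo 3, only the numbers \<open>m u v\<close> of edges
  between vertices matter. The number of vertices is even, so the permutation group induced by the
  nilpotent group has a central involution \<open>z\<close>, and \<open>z\<close> has no fixed point. If no vertex is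
  adjacent to its image under \<open>z\<close>, the graph covers its quotient by \<open>z\<close>, which inherits all
  hypotheses, and a flow of the quotient lifts.

  Otherwise every \<open>v\<close> is joined to \<open>z v\<close> by the same number \<open>c \<ge> 1\<close> of edges. Put values \<open>g\<close> with
  \<open>g (z u) (z v) = - g u v\<close> on the remaining edges; the excesses at \<open>v\<close> and \<open>z v\<close> are then opposite
  and can be cancelled along the edges between \<open>v\<close> and \<open>z v\<close>, provided that no excess is divisible
  by 3 when \<open>c = 1\<close>. Changing the value on one edge moves such a bad excess to a neighbour, so that
  it can be driven, inside a component from which a non-cutting pair \<open>{r, z r}\<close> is removed, to a
  neighbour \<open>u\<close> of \<open>r\<close>. Since \<open>r\<close> has at least three edges not leading to \<open>z r\<close>, the values at \<open>r\<close>
  can be arranged beforehand so that the edge between \<open>r\<close> and \<open>u\<close> absorbs it.\<close>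

section \<open>Modular flows\<close>

text \<open>Summing over all arcs with a signed incidence makes loops cancel and lets the effect of
  changing a single arc be read off.\<close>

definition net_flow :: "('v, 'e) pre_digraph \<Rightarrow> ('e \<Rightarrow> int) \<Rightarrow> 'v \<Rightarrow> int" where
  "net_flow D \<phi> v = (\<Sum>e\<in>arcs D. \<phi> e * (of_bool (tail D e = v) - of_bool (head D e = v)))"

lemma net_flow_eq:
  assumes "finite (arcs D)"
  shows "net_flow D \<phi> v = (\<Sum>e\<in>out_arcs D v. \<phi> e) - (\<Sum>e\<in>in_arcs D v. \<phi> e)"
proof -
  have "net_flow D \<phi> v = (\<Sum>e\<in>arcs D. if tail D e = v then \<phi> e else 0)
      - (\<Sum>e\<in>arcs D. if head D e = v then \<phi> e else 0)"
    unfolding net_flow_def sum_subtractf[symmetric] by (rule sum.cong) auto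
  then show ?thesis
    using assms by (simp add: out_arcs_def in_arcs_def sum.If_cases Int_def)
qed

lemma net_flow_update:
  assumes "finite (arcs D)" "e \<in> arcs D"
  shows "net_flow D (\<phi>(e := x)) v =
    net_flow D \<phi> v + (x - \<phi> e) * (of_bool (tail D e = v) - of_bool (head D e = v))"
proof -
  have "(\<Sum>a\<in>arcs D - {e}. (\<phi>(e := x)) a * (of_bool (tail D a = v) - of_bool (head D a = v)))
    = (\<Sum>a\<in>arcs D - {e}. \<phi> a * (of_bool (tail D a = v) - of_bool (head D a = v)))"
    by (rule sum.cong) auto
  then show ?thesis
    using assms unfolding net_flow_def by (simp add: sum.remove algebra_simps)
qed

text \<open>Arcs with both ends in \<open>X\<close> cancel, so only the boundary of \<open>X\<close>
  contributes. It is applied to the whole vertex set and to a set closed under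
  \<open>flow_step\<close>.\<close>

lemma sum_net_flow:
  assumes "finite X"
  shows "(\<Sum>v\<in>X. net_flow D \<phi> v) = (\<Sum>e\<in>arcs D. \<phi> e * (of_bool (tail D e \<in> X) - of_bool (head D e \<in> X)))"
proof -
  have "(\<Sum>v\<in>X. net_flow D \<phi> v) =
    (\<Sum>e\<in>arcs D. \<Sum>v\<in>X. \<phi> e * (of_bool (tail D e = v) - of_bool (head D e = v)))"
    unfolding net_flow_def by (rule sum.swap)
  also have "\<dots> = (\<Sum>e\<in>arcs D. \<phi> e * (of_bool (tail D e \<in> X) - of_bool (head D e \<in> X)))"
  proof (rule sum.cong[OF refl])
    fix e
    have "(\<Sum>v\<in>X. of_bool (x = v)) = (of_bool (x \<in> X) :: int)" for x
      using assms by (auto simp: of_bool_def)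
    then show "(\<Sum>v\<in>X. \<phi> e * (of_bool (tail D e = v) - of_bool (head D e = v)))
      = \<phi> e * (of_bool (tail D e \<in> X) - of_bool (head D e \<in> X))"
      by (simp add: sum_distrib_left[symmetric] sum_subtractf)
  qed
  finally show ?thesis .
qed

text \<open>Cut the walk at its last visit to \<open>u\<close>: what follows avoids
  \<open>u\<close>. This allows an induction on the size of \<open>X\<close>.\<close>

lemma rtrancl_Restr_last_visit:
  assumes "(u, v) \<in> (Restr r X)\<^sup>*" "u \<noteq> v"
  shows "\<exists>w. (u, w) \<in> r \<and> w \<in> X - {u} \<and> (w, v) \<in> (Restr r (X - {u}))\<^sup>*"
  using assms
proof (induction rule: rtrancl_induct)
  case (step y z)
  show ?case
  proof (cases "y = u")
    case True
    then show ?thesis using step by auto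
  next
    case False
    then obtain w where w: "(u, w) \<in> r" "w \<in> X - {u}" "(w, y) \<in> (Restr r (X - {u}))\<^sup>*"
      using step by auto
    have "(y, z) \<in> Restr r (X - {u})" using step False by auto
    then show ?thesis using w by (meson rtrancl.rtrancl_into_rtrancl)
  qed
qed simp

section \<open>Lifting modular flows to integral flows\<close>

definition flow_step :: "('v, 'e) pre_digraph \<Rightarrow> ('e \<Rightarrow> int) \<Rightarrow> 'v rel" where
  "flow_step D \<phi> = {(u, w). \<exists>e\<in>arcs D.
     \<phi> e > 0 \<and> tail D e = u \<and> head D e = w \<or> \<phi> e < 0 \<and> head D e = u \<and> tail D e = w}"

text \<open>The values are integers in the range of a \<open>k\<close>-flow, not residues; only
  conservation is weakened to divisibility by \<open>k\<close>.\<close>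

definition modular_flow :: "('v, 'e) pre_digraph \<Rightarrow> int \<Rightarrow> ('e \<Rightarrow> int) \<Rightarrow> bool" where
  "modular_flow D k \<phi> \<longleftrightarrow> (\<forall>e\<in>arcs D. 0 < \<bar>\<phi> e\<bar> \<and> \<bar>\<phi> e\<bar> < k) \<and> (\<forall>v\<in>verts D. k dvd net_flow D \<phi> v)"

text \<open>Reversing the first arc of a walk from the surplus vertex \<open>u\<close> to the
  deficient vertex \<open>v\<close> moves \<open>k\<close> units from \<open>u\<close> to the next
  vertex \<open>w\<close>. If \<open>w\<close> was deficient, the total imbalance drops. Otherwise
  it is unchanged, and \<open>w\<close> becomes the surplus vertex of a walk inside the smaller set
  \<open>X - {u}\<close>.\<close>

lemma modular_flow_push:
  assumes fin: "finite (verts D)" "finite (arcs D)"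
    and "finite X" "X \<subseteq> verts D" "u \<in> X" "(u, v) \<in> (Restr (flow_step D \<phi>) X)\<^sup>*"
    and "modular_flow D k \<phi>" "net_flow D \<phi> u > 0" "net_flow D \<phi> v < 0"
  shows "\<exists>\<psi>. modular_flow D k \<psi> \<and>
    (\<Sum>x\<in>verts D. \<bar>net_flow D \<psi> x\<bar>) < (\<Sum>x\<in>verts D. \<bar>net_flow D \<phi> x\<bar>)"
  using assms(3-)
proof (induction "card X" arbitrary: X u \<phi>)
  case 0
  then show ?case by auto
next
  case (Suc n)
  let ?d = "net_flow D \<phi>"
  have "u \<noteq> v" using Suc.prems by auto
  then obtain w where w: "(u, w) \<in> flow_step D \<phi>" "w \<in> X - {u}"
      "(w, v) \<in> (Restr (flow_step D \<phi>) (X - {u}))\<^sup>*"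
    using rtrancl_Restr_last_visit Suc.prems(4) by metis
  then obtain e where e: "e \<in> arcs D"
    "\<phi> e > 0 \<and> tail D e = u \<and> head D e = w \<or> \<phi> e < 0 \<and> head D e = u \<and> tail D e = w"
    unfolding flow_step_def by blast
  \<comment> \<open>The new value has the same residue modulo \<open>k\<close>, the opposite sign,
    and again an absolute value strictly between 0 and \<open>k\<close>.\<close>
  define \<psi> where "\<psi> = \<phi>(e := \<phi> e - k * sgn (\<phi> e))"
  have k: "0 < \<bar>\<phi> e\<bar>" "\<bar>\<phi> e\<bar> < k" using Suc.prems(5) e(1) by (auto simp: modular_flow_def)
  have uw: "u \<noteq> w" "u \<in> verts D" "w \<in> verts D" using w Suc.prems by auto
  have net: "net_flow D \<psi> x = ?d x - k * of_bool (x = u) + k * of_bool (x = w)" for x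
    unfolding \<psi>_def net_flow_update[OF fin(2) e(1)] using e(2) uw(1) by (auto simp: sgn_if)
  have mod: "modular_flow D k \<psi>"
    unfolding modular_flow_def
  proof (intro conjI ballI)
    fix a assume "a \<in> arcs D"
    then have "0 < \<bar>\<phi> a\<bar> \<and> \<bar>\<phi> a\<bar> < k" using Suc.prems(5) by (auto simp: modular_flow_def)
    then show "0 < \<bar>\<psi> a\<bar>" "\<bar>\<psi> a\<bar> < k" using k by (auto simp: \<psi>_def sgn_if)
  next
    fix x assume "x \<in> verts D"
    then show "k dvd net_flow D \<psi> x"
      using Suc.prems(5) unfolding net modular_flow_def by (auto simp: of_bool_def)
  qed
  have "k dvd ?d u" using Suc.prems(5) uw by (auto simp: modular_flow_def)
  \<comment> \<open>A positive multiple of \<open>k\<close> is at least \<open>k\<close>, so the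
    imbalance at \<open>u\<close> stays nonnegative and falls by exactly \<open>k\<close>.\<close>
  then have "k \<le> ?d u" using Suc.prems(6) by (simp add: zdvd_imp_le)
  have split: "(\<Sum>x\<in>verts D. f x) = f u + f w + (\<Sum>x\<in>verts D - {u} - {w}. f x)" for f :: "_ \<Rightarrow> int"
    using fin uw by (simp add: sum.remove[of _ u] sum.remove[of _ w])
  have rest: "(\<Sum>x\<in>verts D - {u} - {w}. \<bar>net_flow D \<psi> x\<bar>) = (\<Sum>x\<in>verts D - {u} - {w}. \<bar>?d x\<bar>)"
    by (rule sum.cong) (auto simp: net)
  show ?case
  proof (cases "?d w < 0")
    case True
    then have "\<bar>net_flow D \<psi> u\<bar> + \<bar>net_flow D \<psi> w\<bar> < \<bar>?d u\<bar> + \<bar>?d w\<bar>"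
      using \<open>k \<le> ?d u\<close> k uw by (auto simp: net)
    then show ?thesis using mod rest by (auto simp: split)
  next
    case False
    then have same: "(\<Sum>x\<in>verts D. \<bar>net_flow D \<psi> x\<bar>) = (\<Sum>x\<in>verts D. \<bar>?d x\<bar>)"
      using \<open>k \<le> ?d u\<close> k uw rest by (auto simp: split net)
    \<comment> \<open>The altered arc is incident with \<open>u\<close>, so every step that avoids
      \<open>u\<close> survives.\<close>
    have "(a, b) \<in> flow_step D \<psi>"
      if ab: "(a, b) \<in> flow_step D \<phi>" "a \<noteq> u" "b \<noteq> u" for a b
    proof -
      from ab obtain c where "c \<in> arcs D"
        "\<phi> c > 0 \<and> tail D c = a \<and> head D c = b \<or> \<phi> c < 0 \<and> head D c = a \<and> tail D c = b"
        unfolding flow_step_def by blast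
      moreover from this have "c \<noteq> e" using ab e by auto
      ultimately show "(a, b) \<in> flow_step D \<psi>"
        unfolding flow_step_def \<psi>_def by auto
    qed
    then have "Restr (flow_step D \<phi>) (X - {u}) \<subseteq> Restr (flow_step D \<psi>) (X - {u})" by auto
    then have "(w, v) \<in> (Restr (flow_step D \<psi>) (X - {u}))\<^sup>*"
      using w(3) rtrancl_mono by blast
    moreover have "v \<noteq> w" using False Suc.prems by auto
    moreover have "n = card (X - {u})" using Suc by (simp add: card_Diff_singleton)
    ultimately show ?thesis
      using Suc.hyps(1)[of "X - {u}" w \<psi>] Suc.prems \<open>u \<noteq> v\<close> w uw mod same False k
      by (auto simp: net)
  qed
qed

text \<open>Tutte's lifting of modular flows, by induction on the total imbalance, which
  \<open>modular_flow_push\<close> lowers as long as some vertex \<open>u\<close> has a surplus. A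
  deficient vertex is reachable from \<open>u\<close> because no value leaves the set
  \<open>X\<close> of reachable vertices: its imbalances have sum at most 0, while \<open>u\<close>
  contributes a positive one.\<close>

lemma modular_flow_imp_flow:
  assumes fin: "finite (verts D)" "finite (arcs D)"
    and wf: "\<And>e. e \<in> arcs D \<Longrightarrow> tail D e \<in> verts D \<and> head D e \<in> verts D"
    and "modular_flow D k \<phi>"
  shows "\<exists>\<psi>. modular_flow D k \<psi> \<and> (\<forall>v\<in>verts D. net_flow D \<psi> v = 0)"
  using assms(4)
proof (induction "nat (\<Sum>x\<in>verts D. \<bar>net_flow D \<phi> x\<bar>)" arbitrary: \<phi> rule: less_induct)
  case less
  let ?d = "net_flow D \<phi>"
  have total: "(\<Sum>v\<in>verts D. ?d v) = 0"
    unfolding sum_net_flow[OF fin(1)] by (rule sum.neutral) (simp add: wf)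
  show ?case
  proof (cases "\<forall>v\<in>verts D. ?d v \<le> 0")
    case True
    then have "\<forall>v\<in>verts D. ?d v = 0"
      using total fin(1) sum_nonneg_eq_0_iff[of "verts D" "\<lambda>v. - ?d v"] by (simp add: sum_negf)
    then show ?thesis using less.prems by blast
  next
    case False
    then obtain u where u: "u \<in> verts D" "?d u > 0" by force
    define R where "R = Restr (flow_step D \<phi>) (verts D)"
    define X where "X = {x. (u, x) \<in> R\<^sup>*}"
    have X: "X \<subseteq> verts D" "u \<in> X"
      using u by (auto simp: X_def R_def elim: rtranclE)
    have finX: "finite X" using X fin finite_subset by blast
    have closed: "b \<in> X" if "a \<in> X" "(a, b) \<in> flow_step D \<phi>" "b \<in> verts D" for a b
    proof -
      have "(a, b) \<in> R" using that X by (auto simp: R_def)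
      then show ?thesis using that by (auto simp: X_def)
    qed
    have "(\<Sum>v\<in>X. ?d v) \<le> 0"
      unfolding sum_net_flow[OF finX]
    proof (rule sum_nonpos)
      fix e assume e: "e \<in> arcs D"
      have "head D e \<in> X" if "\<phi> e > 0" "tail D e \<in> X"
        using closed[of "tail D e" "head D e"] that e wf by (auto simp: flow_step_def)
      moreover have "tail D e \<in> X" if "\<phi> e < 0" "head D e \<in> X"
        using closed[of "head D e" "tail D e"] that e wf by (auto simp: flow_step_def)
      ultimately show "\<phi> e * (of_bool (tail D e \<in> X) - of_bool (head D e \<in> X)) \<le> 0"
        by (cases "\<phi> e" "0 :: int" rule: linorder_cases) auto
    qed
    moreover have "(\<Sum>v\<in>X. ?d v) > 0" if "\<forall>v\<in>X. ?d v \<ge> 0"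
      using that u X finX by (meson sum_pos2)
    ultimately obtain v where "v \<in> X" "?d v < 0" by (meson not_le)
    then obtain \<psi> where \<psi>: "modular_flow D k \<psi>"
      "(\<Sum>x\<in>verts D. \<bar>net_flow D \<psi> x\<bar>) < (\<Sum>x\<in>verts D. \<bar>?d x\<bar>)"
      using modular_flow_push[OF fin fin(1) subset_refl u(1) _ less.prems u(2), of v]
      by (auto simp: X_def R_def)
    moreover have "0 \<le> (\<Sum>x\<in>verts D. \<bar>net_flow D \<psi> x\<bar>)" by (rule sum_nonneg) simp
    ultimately have "nat (\<Sum>x\<in>verts D. \<bar>net_flow D \<psi> x\<bar>) < nat (\<Sum>x\<in>verts D. \<bar>?d x\<bar>)"
      by linarith
    then show ?thesis using less.hyps \<psi>(1) by blast
  qed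
qed

text \<open>The slack between \<open>k\<close> and \<open>l\<close> lets a flow modulo 2 yield a
  3-flow when the valency is even.\<close>

lemma admits_nowhere_zero_flow_if_modular_flow:
  assumes "finite_multigraph G" "orientation G D" "modular_flow D (int k) \<phi>" "k \<le> l"
  shows "admits_nowhere_zero_flow G l"
proof -
  interpret finite_multigraph G by fact
  have D: "verts D = vertices G" "arcs D = edges G" "\<And>e. e \<in> edges G \<Longrightarrow> ends G e = {tail D e, head D e}"
    using assms(2) by (auto simp: orientation_def)
  have fin: "finite (verts D)" "finite (arcs D)" using D finite_vertices finite_edges by auto
  have "tail D e \<in> verts D \<and> head D e \<in> verts D" if "e \<in> arcs D" for e
    using ends_subset D that by auto
  from modular_flow_imp_flow[OF fin this assms(3)]
  obtain \<psi> where \<psi>: "modular_flow D (int k) \<psi>" "\<forall>v\<in>verts D. net_flow D \<psi> v = 0" by blast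
  have "nowhere_zero_flow G l D \<psi>"
    using \<psi> assms(2,4) D net_flow_eq[OF fin(2), of \<psi>]
    by (fastforce simp: nowhere_zero_flow_def modular_flow_def)
  then show ?thesis unfolding admits_nowhere_zero_flow_def by blast
qed


section \<open>Central involutions of nilpotent groups\<close>

lemma (in group) lower_central_series_subgroup: "subgroup (lower_central_series G n) G"
proof (induction n)
  case 0
  show ?case by (simp add: subgroup_self)
next
  case (Suc n)
  have "lower_central_series G n \<subseteq> carrier G" using Suc by (rule subgroup.subset)
  then show ?case by (auto intro!: generate_is_subgroup)
qed

lemma commutator_in_lower_central_series:
  assumes "x \<in> lower_central_series K n" "y \<in> carrier K"
  shows "x \<otimes>\<^bsub>K\<^esub> y \<otimes>\<^bsub>K\<^esub> inv\<^bsub>K\<^esub> x \<otimes>\<^bsub>K\<^esub> inv\<^bsub>K\<^esub> y \<in> lower_central_series K (Suc n)"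
  using assms by (auto intro!: generate.incl)

lemma (in group) lower_central_series_trivial_mono:
  assumes "lower_central_series G n = {\<one>}" "n \<le> m"
  shows "lower_central_series G m = {\<one>}"
  using assms(2)
proof (induction rule: dec_induct)
  case (step k)
  have "(\<Union>y\<in>carrier G. {\<one> \<otimes> y \<otimes> inv \<one> \<otimes> inv y}) = {\<one>}" by auto
  then show ?case using step by (simp add: generate_one)
qed (fact assms(1))

lemma (in group_hom) lower_central_series_img:
  assumes "h ` carrier G = carrier H"
  shows "lower_central_series H n = h ` lower_central_series G n"
proof (induction n)
  case 0
  show ?case using assms by simp
next
  case (Suc n)
  let ?c = "\<lambda>x y. x \<otimes>\<^bsub>G\<^esub> y \<otimes>\<^bsub>G\<^esub> inv\<^bsub>G\<^esub> x \<otimes>\<^bsub>G\<^esub> inv\<^bsub>G\<^esub> y"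
  let ?d = "\<lambda>x y. x \<otimes>\<^bsub>H\<^esub> y \<otimes>\<^bsub>H\<^esub> inv\<^bsub>H\<^esub> x \<otimes>\<^bsub>H\<^esub> inv\<^bsub>H\<^esub> y"
  have sub: "lower_central_series G n \<subseteq> carrier G"
    using G.lower_central_series_subgroup by (rule subgroup.subset)
  have "?d (h x) (h y) = h (?c x y)" if "x \<in> lower_central_series G n" "y \<in> carrier G" for x y
    using that sub by (simp add: subsetD)
  then have "(\<Union>x\<in>lower_central_series H n. \<Union>y\<in>carrier H. {?d x y})
    = h ` (\<Union>x\<in>lower_central_series G n. \<Union>y\<in>carrier G. {?c x y})"
    unfolding Suc.IH assms[symmetric] by (auto simp: image_UN)
  moreover have "(\<Union>x\<in>lower_central_series G n. \<Union>y\<in>carrier G. {?c x y}) \<subseteq> carrier G"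
    using sub by auto
  ultimately show ?case by (simp add: generate_img)
qed

text \<open>Used to pass to the permutation group induced by an action, since a central involution
  of the acting group itself might fix every point.\<close>

lemma (in group_hom) nilpotent_group_img:
  assumes "nilpotent_group G"
  shows "nilpotent_group (H\<lparr>carrier := h ` carrier G\<rparr>)"
proof -
  let ?L = "H\<lparr>carrier := h ` carrier G\<rparr>"
  interpret L: group ?L
    by (rule H.subgroup_imp_group[OF img_is_subgroup])
  interpret hL: group_hom G ?L h
    by unfold_locales (auto simp: hom_def)
  obtain n where "lower_central_series G n = {\<one>\<^bsub>G\<^esub>}"
    using nilpotent_group.nilpotent[OF assms] by blast
  then have "lower_central_series ?L n = {\<one>\<^bsub>?L\<^esub>}"
    using hL.lower_central_series_img[of n] hL.hom_one by simp
  then show ?thesis by unfold_locales blast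
qed

text \<open>An involution \<open>x\<close> as deep as possible in the lower central series is central: \<open>x\<close> inverts
  \<open>c = [x, y]\<close>, so \<open>c\<^sup>2 = [c, x]\<close> and repeated squares of \<open>c\<close> descend to the identity; unless
  \<open>c = \<one>\<close>, the last nontrivial one is a deeper involution.\<close>

lemma (in nilpotent_group) ex_central_involution:
  assumes "finite (carrier K)" "even (order K)"
  shows "\<exists>z\<in>carrier K. z \<noteq> \<one> \<and> z \<otimes> z = \<one> \<and> (\<forall>y\<in>carrier K. z \<otimes> y = y \<otimes> z)"
proof -
  obtain n where n: "lower_central_series K n = {\<one>}" using nilpotent by blast
  define I where "I i = {x \<in> lower_central_series K i. x \<noteq> \<one> \<and> x \<otimes> x = \<one>}" for i
  have "I 0 \<noteq> {}"
  proof -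
    \<comment> \<open>Cauchy's theorem for the prime 2: Sylow's theorem with exponent 1 gives a
      subgroup of order 2, whose nontrivial element is an involution.\<close>
    obtain m where "order K = 2 ^ 1 * m" using assms(2) by auto
    then obtain S where S: "subgroup S K" "card S = 2 ^ 1"
      using sylow_thm[of 2 K 1 m] assms(1) is_group two_is_prime_nat by auto
    interpret S: subgroup S K by fact
    have fin: "finite S" using S(2) by (simp add: card_ge_0_finite)
    have "card (S - {\<one>}) = 1" using S(2) fin by (simp add: card_Diff_singleton)
    then obtain x where x: "S - {\<one>} = {x}" using card_1_singletonE by blast
    then have "x \<in> S" "x \<noteq> \<one>" by auto
    have "x \<otimes> x \<noteq> x" using \<open>x \<in> S\<close> \<open>x \<noteq> \<one>\<close> by (simp add: l_cancel_one)
    then have "x \<otimes> x = \<one>" using x \<open>x \<in> S\<close> S.m_closed by blast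
    then show ?thesis using S.mem_carrier[OF \<open>x \<in> S\<close>] \<open>x \<noteq> \<one>\<close> by (auto simp: I_def)
  qed
  moreover have "I n = {}" using n by (auto simp: I_def)
  ultimately obtain i where i: "I i \<noteq> {}" "I (Suc i) = {}"
    using nat_induct[of "\<lambda>j. I j \<noteq> {}" n] by blast
  then obtain x where x: "x \<in> lower_central_series K i" "x \<noteq> \<one>" "x \<otimes> x = \<one>"
    by (auto simp: I_def)
  have cl: "a \<in> carrier K" if "a \<in> lower_central_series K j" for a j
    using lower_central_series_subgroup that by (rule subgroup.mem_carrier)
  have xc: "x \<in> carrier K" and ix: "inv x = x"
    using cl x by (auto intro: inv_equality)
  \<comment> \<open>Each squaring of \<open>a\<close> raises its level \<open>m\<close> by one, and
    \<open>k\<close> bounds the squarings left before level \<open>n\<close>. Membership at level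
    \<open>Suc i\<close> is kept alongside because no involution lives there: once the square of
    \<open>a\<close> is trivial, so is \<open>a\<close>.\<close>
  have inverted: "a = \<one>"
    if "a \<in> lower_central_series K m" "a \<in> lower_central_series K (Suc i)" "n \<le> m + k"
      "x \<otimes> inv a \<otimes> x = a" for a m k
    using that
  proof (induction k arbitrary: a m)
    case 0
    then show ?case using lower_central_series_trivial_mono[OF n] by auto
  next
    case (Suc k)
    have a: "a \<in> carrier K" using cl Suc.prems by blast
    have "a \<otimes> x \<otimes> inv a \<otimes> inv x = a \<otimes> (x \<otimes> inv a \<otimes> x)"
      using a xc ix by (simp add: m_assoc)
    then have "a \<otimes> x \<otimes> inv a \<otimes> inv x = a \<otimes> a" using Suc.prems by simp
    then have 1: "a \<otimes> a \<in> lower_central_series K (Suc m)"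
      using commutator_in_lower_central_series[OF Suc.prems(1) xc] by metis
    have 2: "a \<otimes> a \<in> lower_central_series K (Suc i)"
      using Suc.prems(2) lower_central_series_subgroup[of "Suc i"] by (simp only: subgroup.m_closed)
    have "x \<otimes> inv (a \<otimes> a) \<otimes> x = (x \<otimes> inv a \<otimes> x) \<otimes> (x \<otimes> inv a \<otimes> x)"
    proof -
      have "(x \<otimes> inv a \<otimes> x) \<otimes> (x \<otimes> inv a \<otimes> x) = x \<otimes> inv a \<otimes> (x \<otimes> x) \<otimes> inv a \<otimes> x"
        using a xc by (simp add: m_assoc)
      then show ?thesis using a xc x(3) by (simp add: m_assoc inv_mult_group)
    qed
    then have "x \<otimes> inv (a \<otimes> a) \<otimes> x = a \<otimes> a" using Suc.prems by simp
    then have "a \<otimes> a = \<one>" using Suc.IH[OF 1 2] Suc.prems by simp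
    then show ?case using i(2) Suc.prems(2) by (auto simp: I_def)
  qed
  have "x \<otimes> y = y \<otimes> x" if y: "y \<in> carrier K" for y
  proof -
    let ?c = "x \<otimes> y \<otimes> inv x \<otimes> inv y"
    have c: "?c \<in> lower_central_series K (Suc i)"
      by (rule commutator_in_lower_central_series[OF x(1) y])
    have "x \<otimes> inv ?c \<otimes> x = x \<otimes> y \<otimes> x \<otimes> inv y \<otimes> (x \<otimes> x)"
      using xc y ix by (simp add: m_assoc inv_mult_group)
    then have "x \<otimes> inv ?c \<otimes> x = ?c" using xc y ix x(3) by simp
    then have "?c = \<one>" using inverted[OF c c, of n] by simp
    then have "x \<otimes> y \<otimes> inv x = y" using xc y by (metis inv_closed inv_equality inv_inv m_closed)
    then show ?thesis using xc y by (metis inv_closed inv_solve_right m_closed)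
  qed
  then show ?thesis using xc x by blast
qed

text \<open>By orbit and stabilizer, \<open>card E\<close> divides the order of the induced
  permutation group, which is therefore even and has a central involution. If that involution fixed
  one point, then by centrality and transitivity it would fix all. Only the permutation induced by
  \<open>c\<close> is a central involution; \<open>c\<close> itself need not be one.\<close>

lemma (in group_action) ex_central_fixpoint_free_involution:
  assumes "nilpotent_group G" "finite E" "E \<noteq> {}" "even (card E)"
    and trans: "\<And>u v. u \<in> E \<Longrightarrow> v \<in> E \<Longrightarrow> \<exists>k\<in>carrier G. \<phi> k u = v"
  shows "\<exists>c\<in>carrier G. (\<forall>v\<in>E. \<phi> c (\<phi> c v) = v \<and> \<phi> c v \<noteq> v) \<and>
    (\<forall>k\<in>carrier G. \<forall>v\<in>E. \<phi> c (\<phi> k v) = \<phi> k (\<phi> c v))"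
proof -
  interpret h: group_hom G "BijGroup E" \<phi> by (rule group_hom)
  let ?L = "(BijGroup E)\<lparr>carrier := \<phi> ` carrier G\<rparr>"
  interpret L: nilpotent_group ?L by (rule h.nilpotent_group_img[OF assms(1)])
  have LB: "f \<in> Bij E" if "f \<in> \<phi> ` carrier G" for f
    using that bij_prop0 by blast
  have mult: "(f \<otimes>\<^bsub>?L\<^esub> g) v = f (g v)" if "f \<in> \<phi> ` carrier G" "g \<in> \<phi> ` carrier G" "v \<in> E" for f g v
    using that LB by (simp add: BijGroup_def compose_eq)
  have one: "\<one>\<^bsub>?L\<^esub> = (\<lambda>v\<in>E. v)" by (simp add: BijGroup_def)
  interpret A: group_action ?L E "\<lambda>f. f"
    by unfold_locales (auto simp: hom_def h.hom_closed)
  have fin: "finite (carrier ?L)"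
  proof (rule finite_subset)
    show "carrier ?L \<subseteq> (E \<rightarrow>\<^sub>E E)"
      using LB by (auto simp: Bij_def bij_betw_def PiE_def)
    show "finite (E \<rightarrow>\<^sub>E E)" using assms(2) by (simp add: finite_PiE)
  qed
  obtain v where v: "v \<in> E" using assms(3) by blast
  have "orbit ?L (\<lambda>f. f) v = E"
    using trans[OF v] v element_image by (fastforce simp: orbit_def)
  then have "even (order ?L)"
    using A.orbit_stabilizer_theorem[OF v] assms(4) by (metis dvd_mult2)
  then obtain z where z: "z \<in> carrier ?L" "z \<noteq> \<one>\<^bsub>?L\<^esub>" "z \<otimes>\<^bsub>?L\<^esub> z = \<one>\<^bsub>?L\<^esub>"
    "\<forall>y\<in>carrier ?L. z \<otimes>\<^bsub>?L\<^esub> y = y \<otimes>\<^bsub>?L\<^esub> z"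
    using L.ex_central_involution[OF fin] by blast
  from z(1) obtain c where c: "c \<in> carrier G" "z = \<phi> c" by auto
  have comm: "\<phi> c (\<phi> k v) = \<phi> k (\<phi> c v)" if "k \<in> carrier G" "v \<in> E" for k v
    using z(4) mult[of "\<phi> c" "\<phi> k" v] mult[of "\<phi> k" "\<phi> c" v] that c by auto
  have "\<phi> c v \<noteq> v" if "v \<in> E" for v
  proof
    assume eq: "\<phi> c v = v"
    have "\<phi> c u = u" if "u \<in> E" for u
      using trans[OF \<open>v \<in> E\<close> that] comm[OF _ \<open>v \<in> E\<close>] eq by auto
    moreover have "\<phi> c \<in> extensional E" using bij_prop0[OF c(1)] by (simp add: Bij_def)
    ultimately have "\<phi> c = (\<lambda>v\<in>E. v)" by (auto simp: extensional_def restrict_def)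
    then show False using z(2) c one by simp
  qed
  moreover have "\<phi> c (\<phi> c v) = v" if "v \<in> E" for v
    using mult[of "\<phi> c" "\<phi> c" v] z(3) one that c by simp
  ultimately show ?thesis using c(1) comm by blast
qed


section \<open>Graphs with a fixed-point-free involution\<close>

text \<open>\<open>g u v\<close> stands for the total value, modulo 3, sent from \<open>u\<close> to
  \<open>v\<close> over all \<open>m u v\<close> parallel edges. Values \<plusminus>1 on the edges
  realize 0 for no edge, a nonzero residue for one edge, and any residue for more.\<close>

definition admissible :: "'v set \<Rightarrow> ('v \<Rightarrow> 'v \<Rightarrow> nat) \<Rightarrow> ('v \<Rightarrow> 'v \<Rightarrow> int) \<Rightarrow> bool" where
  "admissible V m g \<longleftrightarrow> (\<forall>u\<in>V. \<forall>v\<in>V. g v u = - g u v \<and>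
     (m u v = 0 \<longrightarrow> g u v = 0) \<and> (m u v = 1 \<longrightarrow> \<not> 3 dvd g u v))"

definition Z3_flow :: "'v set \<Rightarrow> ('v \<Rightarrow> 'v \<Rightarrow> nat) \<Rightarrow> ('v \<Rightarrow> 'v \<Rightarrow> int) \<Rightarrow> bool" where
  "Z3_flow V m g \<longleftrightarrow> admissible V m g \<and> (\<forall>u\<in>V. 3 dvd (\<Sum>v\<in>V. g u v))"

locale paired_graph =
  fixes V :: "'v set" and z :: "'v \<Rightarrow> 'v" and m :: "'v \<Rightarrow> 'v \<Rightarrow> nat"
  assumes finite_V: "finite V"
    and z_in [simp]: "v \<in> V \<Longrightarrow> z v \<in> V"
    and z_z [simp]: "v \<in> V \<Longrightarrow> z (z v) = v"
    and z_neq: "v \<in> V \<Longrightarrow> z v \<noteq> v"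
    and m_sym: "u \<in> V \<Longrightarrow> v \<in> V \<Longrightarrow> m u v = m v u"
    and m_refl [simp]: "v \<in> V \<Longrightarrow> m v v = 0"
    and m_z [simp]: "u \<in> V \<Longrightarrow> v \<in> V \<Longrightarrow> m (z u) (z v) = m u v"
begin

lemma z_eq_iff: "u \<in> V \<Longrightarrow> v \<in> V \<Longrightarrow> z u = v \<longleftrightarrow> u = z v"
  by auto

lemma z_inj_iff [simp]: "u \<in> V \<Longrightarrow> v \<in> V \<Longrightarrow> z u = z v \<longleftrightarrow> u = v"
  by (metis z_z)

lemma bij_betw_z: "bij_betw z V V"
  by (rule bij_betw_byWitness[where f' = z]) auto

lemma m_z_swap: "u \<in> V \<Longrightarrow> v \<in> V \<Longrightarrow> m (z u) v = m u (z v)"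
  by (metis m_z z_in z_z)

text \<open>The pairs of \<open>u\<close> and \<open>z u\<close> carry nothing yet: they are
  reserved for cancelling the excesses at the end.\<close>

definition anti :: "('v \<Rightarrow> 'v \<Rightarrow> int) \<Rightarrow> bool" where
  "anti g \<longleftrightarrow> (\<forall>u\<in>V. g u (z u) = 0) \<and> (\<forall>u\<in>V. \<forall>v\<in>V. g v u = - g u v \<and> g (z u) (z v) = - g u v \<and>
     (m u v = 0 \<longrightarrow> g u v = 0) \<and> (v \<noteq> z u \<longrightarrow> m u v = 1 \<longrightarrow> \<not> 3 dvd g u v))"

lemma anti_z: "anti g \<Longrightarrow> u \<in> V \<Longrightarrow> v \<in> V \<Longrightarrow> g (z u) (z v) = - g u v"
  unfolding anti_def by blast

definition excess :: "('v \<Rightarrow> 'v \<Rightarrow> int) \<Rightarrow> 'v \<Rightarrow> int" where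
  "excess g u = (\<Sum>v\<in>V. g u v)"

text \<open>If a single edge joins \<open>u\<close> and \<open>z u\<close>, it must carry minus the
  excess at \<open>u\<close>, which then has to be nonzero modulo 3.\<close>

definition bad :: "('v \<Rightarrow> 'v \<Rightarrow> int) \<Rightarrow> 'v set" where
  "bad g = {u \<in> V. 3 dvd excess g u}"

definition adj :: "'v rel" where
  "adj = {(u, v). u \<in> V \<and> v \<in> V \<and> m u v \<ge> 1}"

text \<open>The correction is spread over the images of \<open>(v, w)\<close> under reversal and \<open>z\<close>, which preserves
  \<open>anti\<close>.\<close>

definition shift :: "('v \<Rightarrow> 'v \<Rightarrow> int) \<Rightarrow> 'v \<Rightarrow> 'v \<Rightarrow> int \<Rightarrow> 'v \<Rightarrow> 'v \<Rightarrow> int" where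
  "shift g v w \<delta> a b = g a b + \<delta> * (of_bool (a = v \<and> b = w) - of_bool (a = w \<and> b = v)
     - of_bool (a = z v \<and> b = z w) + of_bool (a = z w \<and> b = z v))"

section \<open>Antisymmetric values and their shifts\<close>

lemma excess_z:
  assumes "anti g" "u \<in> V"
  shows "excess g (z u) = - excess g u"
proof -
  have "excess g (z u) = (\<Sum>v\<in>V. g (z u) (z v))"
    unfolding excess_def by (rule sum.reindex_bij_betw[OF bij_betw_z, symmetric])
  also have "\<dots> = (\<Sum>v\<in>V. - g u v)"
    by (rule sum.cong) (simp_all add: anti_z assms)
  finally show ?thesis by (simp add: excess_def sum_negf)
qed

lemma bad_z: "anti g \<Longrightarrow> u \<in> V \<Longrightarrow> z u \<in> bad g \<longleftrightarrow> u \<in> bad g"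
  by (simp add: bad_def excess_z)

lemma finite_bad: "finite (bad g)"
  using finite_V by (simp add: bad_def)

text \<open>As \<open>w\<close> is neither \<open>v\<close> nor \<open>z v\<close>, the four shifted
  ordered pairs are distinct, and up to sign all of them carry the same value, so the last
  assumption controls them all.\<close>

lemma anti_shift:
  assumes "anti g" "v \<in> V" "w \<in> V" "w \<noteq> v" "w \<noteq> z v" "m v w \<ge> 1"
    and "m v w = 1 \<Longrightarrow> \<not> 3 dvd g v w + \<delta>"
  shows "anti (shift g v w \<delta>)"
proof -
  have ne: "v \<noteq> z v" "w \<noteq> z w" "v \<noteq> w" "v \<noteq> z w" "z v \<noteq> v" "z w \<noteq> w" "z w \<noteq> v" "w \<noteq> z v" "w \<noteq> v"
    using assms z_neq by (metis z_z)+
  have iffs: "z a = v \<longleftrightarrow> a = z v" "z a = w \<longleftrightarrow> a = z w" if "a \<in> V" for a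
    using that assms by (auto simp: z_eq_iff)
  have g: "g b a = - g a b" "g (z a) (z b) = - g a b" "m a b = 0 \<Longrightarrow> g a b = 0"
    "b \<noteq> z a \<Longrightarrow> m a b = 1 \<Longrightarrow> \<not> 3 dvd g a b" "g a (z a) = 0" if "a \<in> V" "b \<in> V" for a b
    using assms(1) that unfolding anti_def by blast+
  show ?thesis unfolding anti_def
  proof (intro conjI ballI impI)
    fix a assume a: "a \<in> V"
    show "shift g v w \<delta> a (z a) = 0"
      using a assms(2,3) ne by (auto simp: shift_def g(5)[OF a a] iffs)
    fix b assume b: "b \<in> V"
    note ab = a b
    show "shift g v w \<delta> b a = - shift g v w \<delta> a b"
      by (simp add: shift_def g(1)[OF ab] conj_commute algebra_simps)
    show "shift g v w \<delta> (z a) (z b) = - shift g v w \<delta> a b"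
    proof -
      \<comment> \<open>Applying \<open>z\<close> to both arguments exchanges the first indicator in
        \<open>shift\<close> with the third and the second with the fourth, and so negates the
        correction.\<close>
      have neg: "x = - y \<Longrightarrow> x + \<delta> * (C - D - A + B) = - (y + \<delta> * (A - B - C + D))"
        for x y A B C D :: int
        by (simp add: algebra_simps)
      show ?thesis
        unfolding shift_def
        by (simp only: iffs[OF a] iffs[OF b] z_inj_iff a b assms(2,3)) (rule neg[OF g(2)[OF ab]])
    qed
    have mm: "m w v = m v w" "m (z v) (z w) = m v w" "m (z w) (z v) = m v w"
      using assms(2,3) m_sym by auto
    have other: "shift g v w \<delta> a b = g a b" if "(a, b) \<notin> {(v, w), (w, v), (z v, z w), (z w, z v)}"
    proof -
      from that have "\<not> (a = v \<and> b = w)" "\<not> (a = w \<and> b = v)" "\<not> (a = z v \<and> b = z w)"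
        "\<not> (a = z w \<and> b = z v)" by blast+
      then show ?thesis by (simp only: shift_def of_bool_eq) simp
    qed
    show "shift g v w \<delta> a b = 0" if "m a b = 0"
    proof -
      have "(a, b) \<notin> {(v, w), (w, v), (z v, z w), (z w, z v)}"
        using that assms(6) mm by force
      then show ?thesis using other g(3)[OF ab that] by simp
    qed
    show "\<not> 3 dvd shift g v w \<delta> a b" if "b \<noteq> z a" "m a b = 1"
    proof (cases "(a, b) \<in> {(v, w), (w, v), (z v, z w), (z w, z v)}")
      case True
      then have "m v w = 1" using that mm by auto
      then have nd: "\<not> 3 dvd g v w + \<delta>" using assms(7) by blast
      have "g w v = - g v w" "g (z v) (z w) = - g v w" "g (z w) (z v) = g v w"
        using assms(2,3) g(1)[of v w] g(1)[of "z v" "z w"] g(2)[of v w] by auto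
      moreover have "shift g v w \<delta> v w = g v w + \<delta>" "shift g v w \<delta> w v = g w v - \<delta>"
        "shift g v w \<delta> (z v) (z w) = g (z v) (z w) - \<delta>"
        "shift g v w \<delta> (z w) (z v) = g (z w) (z v) + \<delta>"
        using ne assms(2,3) by (simp_all add: shift_def)
      ultimately have "shift g v w \<delta> a b = g v w + \<delta> \<or> shift g v w \<delta> a b = - (g v w + \<delta>)"
        using True by fastforce
      then show ?thesis using nd by (metis dvd_minus_iff)
    next
      case False
      then have "shift g v w \<delta> a b = g a b" by (rule other)
      then show ?thesis using g(4)[OF ab that] by simp
    qed
  qed
qed

lemma excess_shift:
  assumes "v \<in> V" "w \<in> V"
  shows "excess (shift g v w \<delta>) a =
    excess g a + \<delta> * (of_bool (a = v) - of_bool (a = w) - of_bool (a = z v) + of_bool (a = z w))"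
proof -
  have "(\<Sum>b\<in>V. of_bool (P \<and> b = c)) = (of_bool P :: int)" if "c \<in> V" for P c
    using that finite_V by (cases P) (auto simp: of_bool_def)
  then show ?thesis using assms
    by (simp add: excess_def shift_def sum.distrib sum_subtractf sum_distrib_left[symmetric])
qed

lemma bad_shift_other:
  assumes "v \<in> V" "w \<in> V" "a \<notin> {v, w, z v, z w}"
  shows "a \<in> bad (shift g v w \<delta>) \<longleftrightarrow> a \<in> bad g"
  using assms by (simp add: bad_def excess_shift)

lemma bad_shift_subset:
  assumes "v \<in> V" "w \<in> V"
  shows "bad (shift g v w \<delta>) - {v, w, z v, z w} \<subseteq> bad g"
  using bad_shift_other[OF assms, of _ g \<delta>] by blast

lemma excess_shift_fst:
  assumes "v \<in> V" "w \<in> V" "w \<noteq> v" "w \<noteq> z v"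
  shows "excess (shift g v w \<delta>) v = excess g v + \<delta>"
proof -
  have "v \<noteq> z v" "v \<noteq> z w" using assms z_neq by (metis z_z)+
  then show ?thesis using assms by (simp add: excess_shift)
qed

lemma excess_shift_snd:
  assumes "v \<in> V" "w \<in> V" "w \<noteq> v" "w \<noteq> z v"
  shows "excess (shift g v w \<delta>) w = excess g w - \<delta>"
proof -
  have "w \<noteq> z w" using assms z_neq by metis
  then show ?thesis using assms by (simp add: excess_shift)
qed

text \<open>\<open>k\<close> labels a pair by the smaller number of its two vertices, and the sign
  \<open>t\<close> tells these two apart. An edge between two pairs takes the sign of its end in the
  pair with the smaller label, counted as leaving that end; \<open>z\<close> keeps the labels and
  flips the signs.\<close>

lemma ex_anti: "\<exists>g. anti g"
proof -
  obtain l :: "'v \<Rightarrow> nat" where l: "inj_on l V"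
    using finite_imp_inj_to_nat_seg[OF finite_V] by blast
  define k where "k u = min (l u) (l (z u))" for u
  define t where "t u = (if l u < l (z u) then 1 else - 1 :: int)" for u
  define g where "g u v = (if m u v = 0 \<or> k u = k v then 0 else if k u < k v then t u else - t v)" for u v
  have kz: "k (z u) = k u" if "u \<in> V" for u using that by (simp add: k_def min.commute)
  have k_eq: "v = u \<or> v = z u" if "k u = k v" "u \<in> V" "v \<in> V" for u v
    using that l by (auto simp: k_def min_def inj_on_eq_iff z_eq_iff split: if_splits)
  have tz: "t (z u) = - t u" if "u \<in> V" for u
    using that l z_neq[OF that] inj_on_eq_iff[OF l, of u "z u"] by (auto simp: t_def)
  have t3: "\<not> 3 dvd t u" for u by (simp add: t_def)
  have "anti g"
    unfolding anti_def
  proof (intro conjI ballI impI)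
    fix u assume u: "u \<in> V"
    show "g u (z u) = 0" using u by (simp add: g_def kz)
    fix v assume v: "v \<in> V"
    show "g v u = - g u v" using u v m_sym[of u v] by (auto simp: g_def)
    show "g (z u) (z v) = - g u v" using u v by (auto simp: g_def kz tz)
    show "g u v = 0" if "m u v = 0" using that by (simp add: g_def)
    show "\<not> 3 dvd g u v" if "v \<noteq> z u" "m u v = 1"
    proof -
      have "k u \<noteq> k v" using k_eq[of u v] that u v by auto
      then show ?thesis using t3 that by (auto simp: g_def)
    qed
  qed
  then show ?thesis by blast
qed

section \<open>Removing a pair from a component\<close>

text \<open>\<open>X\<close> is a maximal connected \<open>z\<close>-invariant proper subset of the component of \<open>s\<close>.\<close>

lemma ex_non_cut_pair:
  assumes s: "s \<in> V" and fibre: "\<And>v. v \<in> V \<Longrightarrow> m v (z v) \<ge> 1"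
    and nbr: "w \<in> V" "w \<noteq> z s" "m s w \<ge> 1"
  shows "\<exists>r X. r \<in> V \<and> X \<subseteq> V \<and> adj\<^sup>* `` {s} = X \<union> {r, z r} \<and> r \<notin> X \<and> z r \<notin> X \<and>
    z ` X \<subseteq> X \<and> (\<forall>x\<in>X. \<forall>y\<in>X. (x, y) \<in> (Restr adj X)\<^sup>*)"
proof -
  define C where "C = adj\<^sup>* `` {s}"
  have CV: "C \<subseteq> V" using s by (auto simp: C_def adj_def elim: rtranclE)
  have sC: "s \<in> C" by (simp add: C_def)
  have C_closed: "b \<in> C" if "a \<in> C" "(a, b) \<in> adj" for a b
    using that by (auto simp: C_def)
  have zadj: "(v, z v) \<in> adj" "(z v, v) \<in> adj" if "v \<in> V" for v
    using that fibre[OF that] fibre[of "z v"] by (auto simp: adj_def)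
  have Cz: "z v \<in> C" if "v \<in> C" for v
    using C_closed[OF that] zadj(1) that CV by blast
  define P where "P Y \<longleftrightarrow> Y \<subseteq> C \<and> Y \<noteq> C \<and> z ` Y \<subseteq> Y \<and> s \<in> Y \<and> (\<forall>y\<in>Y. (y, s) \<in> (Restr adj Y)\<^sup>*)" for Y
  have "w \<in> C" using C_closed[OF sC, of w] s nbr by (auto simp: adj_def)
  moreover have "w \<noteq> s" using nbr by auto
  \<comment> \<open>The neighbour \<open>w\<close> makes the starting set \<open>{s, z s}\<close> a
    proper subset of the component.\<close>
  ultimately have "{s, z s} \<noteq> C" using nbr by blast
  then have "P {s, z s}"
    using s sC Cz[OF sC] zadj(2)[OF s] by (auto simp: P_def)
  have finC: "finite C" using CV finite_V finite_subset by blast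
  then have "finite {Y. P Y}" by (rule finite_subset[rotated, OF finite_Pow_iff[THEN iffD2]]) (auto simp: P_def)
  then obtain Y where Y: "P Y" and max: "\<And>Y'. P Y' \<Longrightarrow> Y \<subseteq> Y' \<Longrightarrow> Y' = Y"
    using finite_has_maximal2[of "{Y. P Y}"] \<open>P {s, z s}\<close> by (metis (full_types) mem_Collect_eq)
  have YV: "Y \<subseteq> V" using Y CV by (auto simp: P_def)
  \<comment> \<open>An edge leaving the maximal set \<open>Y\<close> ends in some \<open>t\<close>.
    Adding \<open>t\<close> and \<open>z t\<close> keeps the set connected, because \<open>t\<close>
    and \<open>z t\<close> are adjacent; by maximality the result is all of \<open>C\<close>, so
    \<open>t\<close> can serve as \<open>r\<close>.\<close>
  obtain y t where yt: "y \<in> Y" "(y, t) \<in> adj" "t \<notin> Y"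
  proof (rule ccontr)
    assume "\<not> thesis"
    then have closed: "\<And>a b. a \<in> Y \<Longrightarrow> (a, b) \<in> adj \<Longrightarrow> b \<in> Y" using that by blast
    have "C \<subseteq> Y"
    proof
      fix c assume "c \<in> C"
      then have "(s, c) \<in> adj\<^sup>*" by (simp add: C_def)
      then show "c \<in> Y" by induction (use Y closed in \<open>auto simp: P_def\<close>)
    qed
    then show False using Y by (auto simp: P_def)
  qed
  have t: "t \<in> V" "t \<in> C" using yt Y C_closed by (auto simp: adj_def P_def)
  have "(t, y) \<in> adj" using yt m_sym by (auto simp: adj_def)
  define Y' where "Y' = Y \<union> {t, z t}"
  have mono: "(a, b) \<in> (Restr adj Y')\<^sup>*" if "(a, b) \<in> (Restr adj Y)\<^sup>*" for a b
    using that by (rule rev_subsetD) (intro rtrancl_mono, auto simp: Y'_def)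
  have ty: "(t, y) \<in> Restr adj Y'" "(z t, t) \<in> Restr adj Y'"
    using \<open>(t, y) \<in> adj\<close> yt zadj(2)[OF t(1)] by (auto simp: Y'_def)
  have ys: "(y, s) \<in> (Restr adj Y')\<^sup>*" using Y yt mono by (auto simp: P_def)
  then have ts: "(t, s) \<in> (Restr adj Y')\<^sup>*" using ty(1) by (meson converse_rtrancl_into_rtrancl)
  then have "(z t, s) \<in> (Restr adj Y')\<^sup>*" using ty(2) by (meson converse_rtrancl_into_rtrancl)
  then have "\<forall>x\<in>Y'. (x, s) \<in> (Restr adj Y')\<^sup>*"
    using ts Y mono by (auto simp: P_def Y'_def)
  moreover have "Y' \<subseteq> C" "z ` Y' \<subseteq> Y'" "s \<in> Y'"
    using Y t Cz by (auto simp: P_def Y'_def)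
  ultimately have "Y' = C" using max[of Y'] yt(3) by (auto simp: P_def Y'_def)
  have "sym (Restr adj Y)" using m_sym by (auto simp: sym_def adj_def)
  then have sym: "sym ((Restr adj Y)\<^sup>*)" by (rule sym_rtrancl)
  have conn: "(a, b) \<in> (Restr adj Y)\<^sup>*" if "a \<in> Y" "b \<in> Y" for a b
    using Y that symD[OF sym] unfolding P_def by (meson rtrancl_trans)
  have "z t \<notin> Y" using Y yt(3) t(1) unfolding P_def by (metis image_subset_iff z_z)
  moreover have "z ` Y \<subseteq> Y" "adj\<^sup>* `` {s} = Y \<union> {t, z t}"
    using Y \<open>Y' = C\<close> by (auto simp: P_def Y'_def C_def)
  ultimately show ?thesis
    using t(1) YV yt(3) conn by (intro exI[of _ t] exI[of _ Y]) simp
qed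

section \<open>Clearing the bad vertices of a component\<close>

lemma move_bad:
  assumes "anti g" "v \<in> bad g" "w \<in> V" "w \<noteq> v" "w \<noteq> z v" "m v w \<ge> 1"
  shows "\<exists>\<delta>. anti (shift g v w \<delta>) \<and> bad (shift g v w \<delta>) \<inter> {v, z v} = {}"
proof -
  have v: "v \<in> V" "3 dvd excess g v" using assms(2) by (auto simp: bad_def)
  have g: "m v w = 1 \<Longrightarrow> \<not> 3 dvd g v w" using assms v unfolding anti_def by blast
  \<comment> \<open>A nonzero value is negated, which keeps it nonzero. A value divisible by 3
    occurs only on at least two parallel edges, where any change is allowed. Either way \<delta> is
    not divisible by 3, so \<open>v\<close> stops being bad, though \<open>w\<close> may become
    so.\<close>
  define \<delta> where "\<delta> = (if 3 dvd g v w then 1 else - 2 * g v w)"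
  have anti: "anti (shift g v w \<delta>)"
  proof (rule anti_shift[OF assms(1) v(1) assms(3-6)])
    assume "m v w = 1"
    then show "\<not> 3 dvd g v w + \<delta>" using g by (simp add: \<delta>_def)
  qed
  have "\<not> 3 dvd \<delta>" unfolding \<delta>_def by presburger
  then have "\<not> 3 dvd excess (shift g v w \<delta>) v"
    using v excess_shift_fst[OF v(1) assms(3-5)] by (simp add: dvd_add_right_iff)
  then have "v \<notin> bad (shift g v w \<delta>)" by (simp add: bad_def)
  then show ?thesis using anti bad_z[OF anti v(1)] by blast
qed

context
  fixes r u :: 'v and X C :: "'v set"
  assumes r: "r \<in> V" and u: "u \<in> X" and nbr: "m r u \<ge> 1" and X: "X \<subseteq> V" "r \<notin> X" "z r \<notin> X" "z ` X \<subseteq> X"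
    and C: "C = X \<union> {r, z r}" and conn: "\<And>x. x \<in> X \<Longrightarrow> (x, u) \<in> (Restr adj X)\<^sup>*"
begin

text \<open>Under \<open>absorbing g\<close>, whatever the values on the edges inside \<open>X\<close>, the value on \<open>{r, u}\<close> can be
  chosen so that neither of its ends is bad.\<close>

definition absorbing :: "('v \<Rightarrow> 'v \<Rightarrow> int) \<Rightarrow> bool" where
  "absorbing g \<longleftrightarrow> anti g \<and> (m r u = 1 \<longrightarrow> 3 dvd excess g r - g r u)"

text \<open>A change \<delta> on the edge between \<open>r\<close> and \<open>u\<close> must avoid
  one residue for \<open>r\<close>, one for \<open>u\<close> and, if the edge is single, one for the
  edge. In the last case \<open>absorbing\<close> makes the conditions for \<open>r\<close> and for
  the edge coincide, so at most two of three residues are forbidden. It persists, since both terms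
  of its difference change by \<delta>.\<close>

lemma absorb:
  assumes "absorbing g"
  shows "\<exists>g'. absorbing g' \<and> bad g' \<subseteq> bad g - {r, z r, u, z u}"
proof -
  have a: "anti g" and abs: "m r u = 1 \<Longrightarrow> 3 dvd excess g r - g r u"
    using assms by (auto simp: absorbing_def)
  have uV: "u \<in> V" "u \<noteq> r" "u \<noteq> z r" using u X by auto
  obtain \<delta> where \<delta>: "m r u = 1 \<Longrightarrow> \<not> 3 dvd g r u + \<delta>"
    "\<not> 3 dvd excess g r + \<delta>" "\<not> 3 dvd excess g u - \<delta>"
  proof (cases "m r u = 1")
    case False
    have "\<exists>\<delta>\<in>{0, 1, 2}. \<not> 3 dvd x + \<delta> \<and> \<not> 3 dvd y - \<delta>" for x y :: int
      by (simp, presburger)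
    then show ?thesis using False that by blast
  next
    case True
    have "\<not> 3 dvd g r u" using a True r uV unfolding anti_def by blast
    \<comment> \<open>Keep the value if \<open>y\<close> is not divisible by 3, and negate it
      otherwise.\<close>
    have "\<exists>\<delta>\<in>{0, - 2 * g r u}. \<not> 3 dvd g r u + \<delta> \<and> \<not> 3 dvd y - \<delta>" for y
    proof (cases "3 dvd y")
      case True
      have "\<not> 3 dvd 2 * g r u" using \<open>\<not> 3 dvd g r u\<close> by presburger
      then show ?thesis using True \<open>\<not> 3 dvd g r u\<close> by (simp add: dvd_add_right_iff)
    qed (use \<open>\<not> 3 dvd g r u\<close> in simp)
    then obtain \<delta> where "\<not> 3 dvd g r u + \<delta>" "\<not> 3 dvd excess g u - \<delta>" by blast
    moreover from this have "\<not> 3 dvd excess g r + \<delta>" using abs[OF True] by presburger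
    ultimately show ?thesis using that by blast
  qed
  let ?g = "shift g r u \<delta>"
  have anti: "anti ?g" by (rule anti_shift[OF a r uV nbr \<delta>(1)])
  have "?g r u = g r u + \<delta>" using uV z_neq[OF r, symmetric] r by (simp add: shift_def)
  then have "absorbing ?g"
    using anti abs excess_shift_fst[OF r uV] by (simp add: absorbing_def)
  moreover have "r \<notin> bad ?g" "u \<notin> bad ?g"
    using \<delta> excess_shift_fst[OF r uV] excess_shift_snd[OF r uV] by (simp_all add: bad_def)
  then have "bad ?g \<inter> {r, z r, u, z u} = {}"
    using bad_z[OF anti r] bad_z[OF anti uV(1)] by simp
  then have "bad ?g \<subseteq> bad g - {r, z r, u, z u}"
    using bad_shift_subset[OF r uV(1), of g \<delta>] by blast
  ultimately show ?thesis by blast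
qed

text \<open>For \<open>w = z v\<close> nothing has to change, since \<open>z\<close> preserves
  badness. Otherwise the shift along \<open>v\<close>, \<open>w\<close> stays within
  \<open>X\<close>, so the values at \<open>r\<close> are untouched. It removes \<open>v\<close> and
  \<open>z v\<close> from the bad set and can add only \<open>w\<close> and \<open>z w\<close>;
  hence the count does not grow, and drops if \<open>w\<close> is not bad.\<close>

lemma absorb_step:
  assumes "absorbing g" "v \<in> bad g" "(v, w) \<in> Restr adj X"
  shows "\<exists>g'. absorbing g' \<and> bad g' - C \<subseteq> bad g - C \<and>
    (card (bad g' \<inter> C) < card (bad g \<inter> C) \<or> card (bad g' \<inter> C) \<le> card (bad g \<inter> C) \<and> w \<in> bad g')"
proof (cases "w = z v")
  case True
  have "w \<in> bad g" using True assms bad_z[of g v] by (auto simp: absorbing_def bad_def)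
  then show ?thesis using assms(1) by blast
next
  case False
  have vw: "v \<in> X" "w \<in> X" "m v w \<ge> 1" using assms(3) by (auto simp: adj_def)
  then have V: "v \<in> V" "w \<in> V" "w \<noteq> v" using X by auto
  have a: "anti g" using assms(1) by (simp add: absorbing_def)
  obtain \<delta> where \<delta>: "anti (shift g v w \<delta>)" "bad (shift g v w \<delta>) \<inter> {v, z v} = {}"
    using move_bad[OF a assms(2) V(2,3) False vw(3)] by blast
  let ?g = "shift g v w \<delta>"
  have ne: "r \<noteq> v" "r \<noteq> w" "r \<noteq> z v" "r \<noteq> z w" using vw X by auto
  have "excess ?g r = excess g r" "?g r u = g r u"
    using ne V by (simp_all add: excess_shift) (simp add: shift_def)
  then have "absorbing ?g" using assms(1) \<delta>(1) by (simp add: absorbing_def)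
  moreover have sub: "bad ?g \<subseteq> bad g - {v, z v} \<union> {w, z w}"
    using bad_shift_subset[OF V(1,2), of g \<delta>] \<delta>(2) by blast
  have zX: "z v \<in> X" "z w \<in> X" using vw X by auto
  have "bad ?g - C \<subseteq> bad g - C" using sub zX vw C by blast
  moreover have "card (bad ?g \<inter> C) < card (bad g \<inter> C)" if "w \<notin> bad ?g"
  proof (rule psubset_card_mono)
    have "z w \<notin> bad ?g" using that bad_z[OF \<delta>(1) V(2)] by simp
    then have "bad ?g \<inter> {w, z w} = {}" using that by simp
    then have "bad ?g \<subseteq> bad g - {v, z v}" using sub by (auto dest: subsetD)
    then show "bad ?g \<inter> C \<subset> bad g \<inter> C" using assms(2) vw(1) C by blast
  qed (use finite_bad in simp)
  moreover have "card (bad ?g \<inter> C) \<le> card (bad g \<inter> C)"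
  proof -
    have f: "finite (bad g \<inter> C)" using finite_bad by simp
    have "{v, z v} \<subseteq> bad g \<inter> C"
      using assms(2) bad_z[OF a V(1)] vw(1) zX C by auto
    moreover have "card {v, z v} = 2" using z_neq[OF V(1)] by simp
    ultimately have "card (bad g \<inter> C - {v, z v}) + 2 = card (bad g \<inter> C)"
      using f by (metis card_Diff_subset card_mono finite_subset le_add_diff_inverse2)
    moreover have "card (bad ?g \<inter> C) \<le> card ((bad g \<inter> C - {v, z v}) \<union> {w, z w})"
      by (rule card_mono) (use f sub in auto)
    moreover have "card ((bad g \<inter> C - {v, z v}) \<union> {w, z w}) \<le> card (bad g \<inter> C - {v, z v}) + card {w, z w}"
      by (rule card_Un_le)
    moreover have "card {w, z w} = 2" using z_neq[OF V(2)] by simp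
    ultimately show ?thesis by linarith
  qed
  ultimately show ?thesis by blast
qed

text \<open>Badness is carried along the walk until the count drops; at the latest this happens at
  \<open>u\<close>, by \<open>absorb\<close>.\<close>

lemma absorb_walk:
  assumes "(v, u) \<in> (Restr adj X)\<^sup>*" "absorbing g" "v \<in> bad g" "v \<in> X"
  shows "\<exists>g'. absorbing g' \<and> bad g' - C \<subseteq> bad g - C \<and> card (bad g' \<inter> C) < card (bad g \<inter> C)"
  using assms
proof (induction arbitrary: g rule: converse_rtrancl_induct)
  case base
  obtain g' where g': "absorbing g'" "bad g' \<subseteq> bad g - {r, z r, u, z u}"
    using absorb[OF base(1)] by blast
  have "bad g' \<inter> C \<subset> bad g \<inter> C" using g'(2) base C by blast
  then have "card (bad g' \<inter> C) < card (bad g \<inter> C)"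
    using finite_bad by (simp add: psubset_card_mono)
  then show ?case using g' by blast
next
  case (step v w)
  obtain g' where g': "absorbing g'" "bad g' - C \<subseteq> bad g - C"
    "card (bad g' \<inter> C) < card (bad g \<inter> C) \<or> card (bad g' \<inter> C) \<le> card (bad g \<inter> C) \<and> w \<in> bad g'"
    using absorb_step[OF step.prems(1,2) step.hyps(1)] by blast
  show ?case
  proof (cases "card (bad g' \<inter> C) < card (bad g \<inter> C)")
    case True
    then show ?thesis using g' by blast
  next
    case False
    then have le: "card (bad g' \<inter> C) \<le> card (bad g \<inter> C)" "w \<in> bad g'" using g'(3) by auto
    have "w \<in> X" using step.hyps(1) by auto
    from step.IH[OF g'(1) le(2) this] obtain h where
      "absorbing h" "bad h - C \<subseteq> bad g' - C" "card (bad h \<inter> C) < card (bad g' \<inter> C)" by blast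
    then show ?thesis using g'(2) le(1) by (meson order_trans less_le_trans)
  qed
qed

text \<open>Bad vertices in \<open>X\<close> are walked to \<open>u\<close>, while \<open>r\<close>
  and \<open>z r\<close> are cleared by \<open>absorb\<close> directly.\<close>

lemma absorb_all:
  assumes "absorbing g"
  shows "\<exists>g'. anti g' \<and> bad g' \<subseteq> bad g - C"
  using assms
proof (induction "card (bad g \<inter> C)" arbitrary: g rule: less_induct)
  case less
  show ?case
  proof (cases "bad g \<inter> C = {}")
    case True
    then show ?thesis using less.prems by (auto simp: absorbing_def)
  next
    case False
    then obtain v where v: "v \<in> bad g" "v \<in> C" by blast
    have "\<exists>g'. absorbing g' \<and> bad g' - C \<subseteq> bad g - C \<and> card (bad g' \<inter> C) < card (bad g \<inter> C)"
    proof (cases "v \<in> X")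
      case True
      then show ?thesis using absorb_walk[OF conn less.prems v(1)] by blast
    next
      case False
      obtain g' where g': "absorbing g'" "bad g' \<subseteq> bad g - {r, z r, u, z u}"
        using absorb[OF less.prems] by blast
      have "bad g' \<inter> C \<subset> bad g \<inter> C" using g'(2) v False C by blast
      then have "card (bad g' \<inter> C) < card (bad g \<inter> C)"
        using finite_bad by (simp add: psubset_card_mono)
      then show ?thesis using g' by blast
    qed
    then obtain g' where "absorbing g'" "bad g' - C \<subseteq> bad g - C" "card (bad g' \<inter> C) < card (bad g \<inter> C)"
      by blast
    then show ?thesis using less.hyps[of g'] by blast
  qed
qed

end

text \<open>A multiple edge from \<open>r\<close> to some \<open>u\<close> other than
  \<open>z r\<close> needs no preparation. Without one, the valency gives \<open>r\<close> three
  neighbours \<open>u\<close>, \<open>v\<close>, \<open>w\<close> besides \<open>z r\<close>, and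
  resetting the values towards \<open>v\<close> and \<open>w\<close> adjusts the excess at
  \<open>r\<close> apart from \<open>u\<close>. New bad vertices stay in the component of
  \<open>r\<close>, which is cleared afterwards.\<close>

lemma ex_absorbing_neighbour:
  assumes "anti g" "r \<in> V" "m r (z r) = 1" "(\<Sum>v\<in>V. m r v) \<ge> 4"
  shows "\<exists>g' u. u \<in> V \<and> u \<noteq> z r \<and> m r u \<ge> 1 \<and> anti g' \<and> (m r u = 1 \<longrightarrow> 3 dvd excess g' r - g' r u) \<and>
    bad g' - adj\<^sup>* `` {r} \<subseteq> bad g"
proof (cases "\<exists>u\<in>V. u \<noteq> z r \<and> m r u \<ge> 2")
  case True
  then obtain u where "u \<in> V" "u \<noteq> z r" "m r u \<ge> 2" by blast
  then show ?thesis using assms(1) by (intro exI[of _ g] exI[of _ u]) auto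
next
  case False
  define N where "N = {v \<in> V. v \<noteq> z r \<and> m r v = 1}"
  have le: "m r v = 0 \<or> m r v = 1" if "v \<in> V" for v
    using that False assms(3) by (cases "v = z r") force+
  have "(\<Sum>v\<in>V. m r v) = (\<Sum>v\<in>insert (z r) N. m r v)"
  proof (rule sum.mono_neutral_right)
    show "\<forall>v\<in>V - insert (z r) N. m r v = 0" using le unfolding N_def by blast
  qed (use finite_V assms(2) in \<open>auto simp: N_def\<close>)
  also have "\<dots> = (\<Sum>v\<in>insert (z r) N. 1)"
    by (rule sum.cong) (use assms(3) in \<open>auto simp: N_def\<close>)
  also have "\<dots> = Suc (card N)" using finite_V by (simp add: N_def)
  finally have "3 \<le> card N" using assms(4) by simp
  then obtain T where "T \<subseteq> N" "card T = 3" by (meson obtain_subset_with_card_n)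
  then obtain u v w where N: "u \<in> N" "v \<in> N" "w \<in> N" and ne: "u \<noteq> v" "u \<noteq> w" "v \<noteq> w"
    by (auto simp: card_3_iff)
  have V: "x \<in> V" "x \<noteq> r" "x \<noteq> z r" "m r x \<ge> 1" if "x \<in> N" for x
    using that assms(2) by (auto simp: N_def)
  \<comment> \<open>The sums -2, 0 and 2 represent all residues modulo 3.\<close>
  have "\<exists>x\<in>{1, -1}. \<exists>y\<in>{1, -1}. 3 dvd s + x + y" for s :: int
    by (simp, presburger)
  then obtain x y where xy: "x \<in> {1, -1}" "y \<in> {1, -1}"
    "3 dvd (excess g r - g r u - g r v - g r w) + x + y" by blast
  have n3: "\<not> 3 dvd x" "\<not> 3 dvd y" using xy(1,2) by auto
  define g1 where "g1 = shift g r v (x - g r v)"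
  have a1: "anti g1"
    unfolding g1_def by (rule anti_shift[OF assms(1,2) V[OF N(2)]]) (simp add: n3)
  have pos: "shift h r t \<delta> r s = h r s" if "t \<in> N" "s \<in> N" "s \<noteq> t" for h t s \<delta>
  proof -
    have "r \<noteq> z r" "r \<noteq> t" "r \<noteq> z t" using that V[OF that(1)] z_neq[OF assms(2)] assms(2) by auto
    then show ?thesis using that by (simp add: shift_def)
  qed
  have g1: "g1 r u = g r u" "g1 r w = g r w" "excess g1 r = excess g r + (x - g r v)"
    using pos N ne excess_shift_fst[OF assms(2) V(1-3)[OF N(2)]] by (auto simp: g1_def)
  define g2 where "g2 = shift g1 r w (y - g1 r w)"
  have a2: "anti g2"
    unfolding g2_def by (rule anti_shift[OF a1 assms(2) V[OF N(3)]]) (simp add: n3)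
  have g2: "g2 r u = g r u" "excess g2 r = excess g r + (x - g r v) + (y - g r w)"
    using pos N ne g1 excess_shift_fst[OF assms(2) V(1-3)[OF N(3)]] by (auto simp: g2_def)
  have "3 dvd excess g2 r - g2 r u"
    using xy(3) by (simp add: g2 algebra_simps)
  moreover have "bad g2 - adj\<^sup>* `` {r} \<subseteq> bad g"
  proof -
    have 1: "x \<in> adj\<^sup>* `` {r}" if "(r, x) \<in> adj" for x using that by auto
    have rz: "(r, z r) \<in> adj" using assms by (auto simp: adj_def)
    have rt: "t \<in> adj\<^sup>* `` {r} \<and> z t \<in> adj\<^sup>* `` {r}" if "t \<in> N" for t
    proof -
      have "(r, t) \<in> adj" "(z r, z t) \<in> adj" using that V[OF that] assms(2) by (auto simp: adj_def)
      then show ?thesis using rz by (auto intro: rtrancl_trans)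
    qed
    have "bad g2 - {r, z r, w, z w} \<subseteq> bad g1"
      unfolding g2_def using bad_shift_subset[OF assms(2) V(1)[OF N(3)]] by blast
    moreover have "bad g1 - {r, z r, v, z v} \<subseteq> bad g"
      unfolding g1_def using bad_shift_subset[OF assms(2) V(1)[OF N(2)]] by blast
    moreover have "{r, z r, v, z v, w, z w} \<subseteq> adj\<^sup>* `` {r}"
      using rt N 1[OF rz] by auto
    ultimately show ?thesis by blast
  qed
  ultimately show ?thesis using a2 V[OF N(1)] by blast
qed

text \<open>Each round clears the whole component of one bad vertex and creates no bad vertex
  elsewhere, so the number of bad vertices falls.\<close>

lemma ex_anti_no_bad:
  assumes fibre: "\<And>v. v \<in> V \<Longrightarrow> m v (z v) = 1" and deg: "\<And>v. v \<in> V \<Longrightarrow> (\<Sum>w\<in>V. m v w) \<ge> 4"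
  shows "\<exists>g. anti g \<and> bad g = {}"
proof -
  have "\<exists>g'. anti g' \<and> bad g' = {}" if "anti g" for g
    using that
  proof (induction "card (bad g)" arbitrary: g rule: less_induct)
    case less
    show ?case
    proof (cases "bad g = {}")
      case False
      then obtain s where s: "s \<in> bad g" by blast
      then have sV: "s \<in> V" by (simp add: bad_def)
      \<comment> \<open>Only the existence of a neighbour of \<open>s\<close> other than
        \<open>z s\<close> is taken from the lemma here.\<close>
      obtain w where w: "w \<in> V" "w \<noteq> z s" "m s w \<ge> 1"
        using ex_absorbing_neighbour[OF less.prems sV fibre[OF sV] deg[OF sV]] by blast
      obtain r X where rX: "r \<in> V" "X \<subseteq> V" "adj\<^sup>* `` {s} = X \<union> {r, z r}" "r \<notin> X" "z r \<notin> X"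
        "z ` X \<subseteq> X" "\<And>x y. x \<in> X \<Longrightarrow> y \<in> X \<Longrightarrow> (x, y) \<in> (Restr adj X)\<^sup>*"
        using ex_non_cut_pair[OF sV _ w] fibre by (metis order_refl)
      have "sym (adj\<^sup>*)" using m_sym by (intro sym_rtrancl) (auto simp: sym_def adj_def)
      moreover have sr: "(s, r) \<in> adj\<^sup>*" using rX(3) by blast
      ultimately have "(r, s) \<in> adj\<^sup>*" by (rule symD)
      then have C: "adj\<^sup>* `` {r} = X \<union> {r, z r}"
        unfolding rX(3)[symmetric] using sr by (auto intro: rtrancl_trans)
      obtain g' u where u: "u \<in> V" "u \<noteq> z r" "m r u \<ge> 1" "anti g'"
        "m r u = 1 \<Longrightarrow> 3 dvd excess g' r - g' r u" "bad g' - (X \<union> {r, z r}) \<subseteq> bad g"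
        using ex_absorbing_neighbour[OF less.prems rX(1) fibre[OF rX(1)] deg[OF rX(1)]] C by metis
      have "(r, u) \<in> adj" using u rX by (auto simp: adj_def)
      then have "u \<in> X \<union> {r, z r}" using C by blast
      moreover have "u \<noteq> r" using u rX by auto
      ultimately have "u \<in> X" using u by blast
      note ctx = rX(1) \<open>u \<in> X\<close> u(3) rX(2,4,5,6) refl rX(7)[OF _ \<open>u \<in> X\<close>]
      have "absorbing r u g'" using u by (simp add: absorbing_def[OF ctx])
      from absorb_all[OF ctx this] obtain h where h: "anti h" "bad h \<subseteq> bad g' - (X \<union> {r, z r})"
        by blast
      have "s \<in> X \<union> {r, z r}" using rX(3) by blast
      then have "bad h \<subset> bad g" using h u(6) s by blast
      then have "card (bad h) < card (bad g)" using finite_bad by (simp add: psubset_card_mono)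
      then show ?thesis using less.hyps h(1) by blast
    qed (use less.prems in blast)
  qed
  then show ?thesis using ex_anti by blast
qed

lemma ex_Z3_flow_fibre_edges:
  assumes "c \<ge> 1" and fibre: "\<And>v. v \<in> V \<Longrightarrow> m v (z v) = c" and deg: "\<And>v. v \<in> V \<Longrightarrow> (\<Sum>w\<in>V. m v w) \<ge> 4"
  shows "\<exists>g. Z3_flow V m g"
proof -
  obtain g where g: "anti g" "c = 1 \<Longrightarrow> bad g = {}"
    using ex_anti_no_bad[OF _ deg] fibre ex_anti by (cases "c = 1") auto
  \<comment> \<open>The edges from \<open>u\<close> to \<open>z u\<close> carry minus the excess at
    \<open>u\<close>. This is antisymmetric because the excesses at \<open>u\<close> and
    \<open>z u\<close> are opposite.\<close>
  define h where "h u v = g u v - (if v = z u then excess g u else 0)" for u v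
  have "Z3_flow V m h"
    unfolding Z3_flow_def admissible_def
  proof (intro conjI ballI impI)
    fix u assume u: "u \<in> V"
    have "(\<Sum>v\<in>V. h u v) = 0"
      using u finite_V by (simp add: h_def sum_subtractf excess_def)
    then show "3 dvd (\<Sum>v\<in>V. h u v)" by simp
    fix v assume v: "v \<in> V"
    have guv: "g v u = - g u v" "m u v = 0 \<Longrightarrow> g u v = 0" "g u (z u) = 0"
      "v \<noteq> z u \<Longrightarrow> m u v = 1 \<Longrightarrow> \<not> 3 dvd g u v"
      using g(1) u v unfolding anti_def by blast+
    show "h v u = - h u v"
      using guv(1) u v excess_z[OF g(1) u] by (auto simp: h_def)
    show "h u v = 0" if "m u v = 0"
      using that guv(2) fibre[OF u] assms(1) by (auto simp: h_def)
    show "\<not> 3 dvd h u v" if "m u v = 1"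
    proof (cases "v = z u")
      case True
      then have "bad g = {}" using that fibre[OF u] g(2) by simp
      then have "\<not> 3 dvd excess g u" using u by (auto simp: bad_def)
      then show ?thesis using True guv(3) by (simp add: h_def)
    next
      case False
      then show ?thesis using guv(4) that by (simp add: h_def)
    qed
  qed
  then show ?thesis by blast
qed

end


section \<open>Descent to quotients\<close>

context paired_graph
begin

text \<open>The multiplicity between the orbits of \<open>a\<close> and \<open>b\<close>, counted at
  the single vertex \<open>a\<close>; the invariance of \<open>m\<close> under \<open>z\<close>
  makes it independent of representatives.\<close>

definition quot :: "'v \<Rightarrow> 'v \<Rightarrow> nat" where
  "quot a b = m a b + m a (z b)"

lemma quot_sym: "a \<in> V \<Longrightarrow> b \<in> V \<Longrightarrow> quot a b = quot b a"
  using m_z_swap[of b a] m_sym[of a b] m_sym[of a "z b"] by (simp add: quot_def)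

context
  fixes T :: "'v set"
  assumes T: "T \<subseteq> V" "\<And>v. v \<in> V \<Longrightarrow> z v \<in> T \<longleftrightarrow> v \<notin> T"
begin

definition rep :: "'v \<Rightarrow> 'v" where
  "rep v = (if v \<in> T then v else z v)"

lemma rep_in: "v \<in> V \<Longrightarrow> rep v \<in> T"
  using T by (simp add: rep_def)

lemma rep_z: "v \<in> V \<Longrightarrow> rep (z v) = rep v"
  using T by (simp add: rep_def)

lemma rep_cases: "rep v = v \<or> rep v = z v"
  by (simp add: rep_def)

lemma sum_transversal:
  fixes f :: "'v \<Rightarrow> 'b :: comm_monoid_add"
  shows "(\<Sum>v\<in>V. f v) = (\<Sum>q\<in>T. f q + f (z q))"
proof -
  have inj: "inj_on z T" using T by (auto simp: inj_on_def subsetD)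
  have "V = T \<union> z ` T" using T by (auto simp: image_iff) (metis z_in z_z)
  moreover have "T \<inter> z ` T = {}" using T by auto
  moreover have "finite T" using T finite_V finite_subset by blast
  ultimately have "(\<Sum>v\<in>V. f v) = (\<Sum>q\<in>T. f q) + (\<Sum>v\<in>z ` T. f v)"
    by (metis finite_imageI sum.union_disjoint)
  then show ?thesis using inj by (simp add: sum.reindex sum.distrib)
qed

lemma quot_rep: "a \<in> V \<Longrightarrow> b \<in> V \<Longrightarrow> quot (rep a) (rep b) = quot a b"
  by (simp add: quot_def rep_def m_z_swap)

text \<open>A quotient value \<open>H u v\<close> has to be split between the edges from
  \<open>u\<close> to \<open>v\<close> and those from \<open>u\<close> to \<open>z v\<close>. If
  only one of these bundles exists, it takes everything. If both exist, each should get a nonzero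
  residue in case it is a single edge: for nonzero \<open>H\<close> both get \<open>- H\<close>, as
  -2 is 1 modulo 3; for zero \<open>H\<close> they get opposite signs, since \<open>t\<close>
  differs on \<open>v\<close> and \<open>z v\<close>.\<close>

lemma Z3_flow_lift:
  assumes fibre: "\<And>v. v \<in> V \<Longrightarrow> m v (z v) = 0" and flow: "Z3_flow T quot h"
  shows "\<exists>g. Z3_flow V m g"
proof -
  obtain l :: "'v \<Rightarrow> nat" where l: "inj_on l V"
    using finite_imp_inj_to_nat_seg[OF finite_V] by blast
  define s :: "'v \<Rightarrow> 'v \<Rightarrow> int" where "s p q = (if l p < l q then 1 else - 1)" for p q
  define t :: "'v \<Rightarrow> int" where "t v = (if v \<in> T then 1 else - 1)" for v
  define H where "H u v = h (rep u) (rep v)" for u v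
  define g where "g u v = (if m u v = 0 then 0 else if m u (z v) = 0 then H u v
    else if 3 dvd H u v then s (rep u) (rep v) * t u * t v else - H u v)" for u v
  have H: "H v u = - H u v" "quot u v = 0 \<Longrightarrow> H u v = 0" "quot u v = 1 \<Longrightarrow> \<not> 3 dvd H u v"
    if "u \<in> V" "v \<in> V" for u v
    using flow rep_in[OF that(1)] rep_in[OF that(2)] quot_rep[OF that]
    unfolding Z3_flow_def admissible_def H_def by metis+
  \<comment> \<open>Adjacent vertices lie in different orbits because \<open>m v (z v)\<close>
    vanishes, so the numbering separates their representatives.\<close>
  have s: "s (rep v) (rep u) = - s (rep u) (rep v)" if "u \<in> V" "v \<in> V" "m u v \<noteq> 0" for u v
  proof -
    have "v \<noteq> u" "v \<noteq> z u" using that fibre by auto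
    then have "rep u \<noteq> rep v"
      using that T by (auto simp: rep_def z_eq_iff)
    then have "l (rep u) \<noteq> l (rep v)"
      using l that rep_in T by (auto simp: inj_on_eq_iff subsetD)
    then show ?thesis by (simp add: s_def)
  qed
  have "Z3_flow V m g"
    unfolding Z3_flow_def admissible_def
  proof (intro conjI ballI impI)
    fix u assume u: "u \<in> V"
    have "3 dvd g u q + g u (z q) - h (rep u) q" if q: "q \<in> T" for q
    proof -
      have qV: "q \<in> V" "rep q = q" "z q \<notin> T" using q T by (auto simp: rep_def)
      have Hq: "H u q = h (rep u) q" "H u (z q) = h (rep u) q"
        using rep_z[OF qV(1)] qV(2) by (simp_all add: H_def)
      have tq: "t q = 1" "t (z q) = - 1" using q qV by (simp_all add: t_def)
      have "m u q + m u (z q) = 0 \<Longrightarrow> h (rep u) q = 0"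
        using H(2)[OF u qV(1)] Hq by (simp add: quot_def)
      then show ?thesis
        using Hq tq qV rep_z[OF qV(1)] by (auto simp: g_def)
    qed
    then have "3 dvd (\<Sum>q\<in>T. g u q + g u (z q) - h (rep u) q)" by (rule dvd_sum)
    moreover have "3 dvd (\<Sum>q\<in>T. h (rep u) q)"
      using flow rep_in[OF u] by (simp add: Z3_flow_def)
    ultimately show "3 dvd (\<Sum>v\<in>V. g u v)"
      unfolding sum_transversal sum_subtractf by (metis diff_add_cancel dvd_add)
    fix v assume v: "v \<in> V"
    have mz: "m v (z u) = m u (z v)" using m_z_swap[OF v u] m_sym[of "z v" u] u v by simp
    show "g v u = - g u v"
      using H(1)[OF u v] s[OF u v] mz m_sym[OF u v] by (simp add: g_def)
    show "g u v = 0" if "m u v = 0" using that by (simp add: g_def)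
    show "\<not> 3 dvd g u v" if "m u v = 1"
    proof (cases "m u (z v) = 0")
      case True
      then show ?thesis using that H(3)[OF u v] by (simp add: g_def quot_def)
    next
      case False
      then show ?thesis using that by (simp add: g_def s_def t_def)
    qed
  qed
  then show ?thesis by blast
qed

end

end

section \<open>Induction over quotients for a nilpotent group\<close>

lemma even_sum_sum_symmetric:
  fixes m :: "'v \<Rightarrow> 'v \<Rightarrow> nat"
  assumes "finite V" "\<And>u v. u \<in> V \<Longrightarrow> v \<in> V \<Longrightarrow> m u v = m v u" "\<And>v. v \<in> V \<Longrightarrow> m v v = 0"
  shows "even (\<Sum>u\<in>V. \<Sum>v\<in>V. m u v)"
  using assms
proof (induction V)
  case (insert a V)
  have "(\<Sum>u\<in>V. m u a) = (\<Sum>v\<in>V. m a v)"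
    by (rule sum.cong) (use insert.prems in auto)
  then show ?case using insert by (simp add: sum.distrib)
qed simp

text \<open>Stated for multiplicities and a possibly unfaithful action of a fixed group
  \<open>K\<close>, so that the quotient by \<open>z\<close> is again an instance, with the same
  \<open>K\<close> and \<open>d\<close> and half as many vertices.\<close>

lemma ex_Z3_flow_nilpotent:
  fixes V :: "'v set" and m :: "'v \<Rightarrow> 'v \<Rightarrow> nat"
  assumes "nilpotent_group K" "odd d" "d \<ge> 4" "group_action K V \<phi>" "finite V"
    and "\<And>u v. u \<in> V \<Longrightarrow> v \<in> V \<Longrightarrow> \<exists>k\<in>carrier K. \<phi> k u = v"
    and "\<And>u v. u \<in> V \<Longrightarrow> v \<in> V \<Longrightarrow> m u v = m v u"
    and "\<And>v. v \<in> V \<Longrightarrow> m v v = 0"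
    and "\<And>k u v. k \<in> carrier K \<Longrightarrow> u \<in> V \<Longrightarrow> v \<in> V \<Longrightarrow> m (\<phi> k u) (\<phi> k v) = m u v"
    and "\<And>u. u \<in> V \<Longrightarrow> (\<Sum>v\<in>V. m u v) = d"
  shows "\<exists>g. Z3_flow V m g"
  using assms(4-)
proof (induction "card V" arbitrary: V \<phi> m rule: less_induct)
  case less
  note trans = less.prems(3) and m_inv = less.prems(6)
  interpret group_action K V \<phi> by (rule less.prems)
  interpret hom: group_hom K "BijGroup V" \<phi> by (rule group_hom)
  show ?case
  proof (cases "V = {}")
    case True
    then have "Z3_flow V m (\<lambda>_ _. 0)" by (simp add: Z3_flow_def admissible_def)
    then show ?thesis by blast
  next
    case False
    then obtain v0 where v0: "v0 \<in> V" by blast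
    \<comment> \<open>Handshaking: the double sum is \<open>card V * d\<close> with \<open>d\<close>
      odd.\<close>
    have "even (\<Sum>u\<in>V. \<Sum>v\<in>V. m u v)"
      by (rule even_sum_sum_symmetric[OF less.prems(2,4,5)])
    then have "even (card V)" using less.prems(7) assms(2) by simp
    then obtain c where c: "c \<in> carrier K" "\<And>v. v \<in> V \<Longrightarrow> \<phi> c (\<phi> c v) = v"
      "\<And>v. v \<in> V \<Longrightarrow> \<phi> c v \<noteq> v" "\<And>k v. k \<in> carrier K \<Longrightarrow> v \<in> V \<Longrightarrow> \<phi> c (\<phi> k v) = \<phi> k (\<phi> c v)"
      using ex_central_fixpoint_free_involution[OF assms(1) less.prems(2) False _ trans] by blast
    define z where "z = \<phi> c"
    have act: "\<phi> k v \<in> V" if "k \<in> carrier K" "v \<in> V" for k v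
      using that element_image by blast
    interpret paired_graph V z m
    proof
      show "m u v = m v u" if "u \<in> V" "v \<in> V" for u v by (rule less.prems(4)[OF that])
      show "m (z u) (z v) = m u v" if "u \<in> V" "v \<in> V" for u v
        unfolding z_def by (rule m_inv[OF c(1) that])
    qed (use less.prems(2,5) c(2,3) act[OF c(1)] in \<open>simp_all add: z_def\<close>)
    have zk: "z (\<phi> k v) = \<phi> k (z v)" if "k \<in> carrier K" "v \<in> V" for k v
      using c(4) that by (simp add: z_def)
    \<comment> \<open>The involution commutes with the transitive action, so all pairs are joined
      alike.\<close>
    have fibre: "m v (z v) = m v0 (z v0)" if v: "v \<in> V" for v
    proof -
      obtain k where "k \<in> carrier K" "\<phi> k v0 = v" using trans[OF v0 v] by blast
      then show ?thesis using m_inv[of k v0 "z v0"] zk[of k v0] v0 by auto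
    qed
    show ?thesis
    proof (cases "m v0 (z v0) = 0")
      case False
      then show ?thesis
        using ex_Z3_flow_fibre_edges[of "m v0 (z v0)"] fibre less.prems(7) assms(3) by auto
    next
      case True
      obtain l :: "'v \<Rightarrow> nat" where l: "inj_on l V"
        using finite_imp_inj_to_nat_seg[OF finite_V] by blast
      define T where "T = {v \<in> V. l v < l (z v)}"
      have "l (z v) \<noteq> l v" if "v \<in> V" for v
        using that l z_neq[OF that] by (simp add: inj_on_eq_iff)
      then have T: "T \<subseteq> V" "z v \<in> T \<longleftrightarrow> v \<notin> T" if "v \<in> V" for v
        using that by (auto simp: T_def) (metis nat_neq_iff)
      have T: "T \<subseteq> V" "\<And>v. v \<in> V \<Longrightarrow> z v \<in> T \<longleftrightarrow> v \<notin> T" using T v0 by blast+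
      let ?rep = "rep T" and ?M = "quot"
      \<comment> \<open>The action on orbits, transported to the transversal \<open>T\<close>. It is
        well defined because \<open>z\<close> commutes with every \<open>\<phi> k\<close>, and
        restricted to \<open>T\<close> because \<open>Bij\<close> asks for extensional maps.\<close>
      define \<psi> where "\<psi> k = (\<lambda>v\<in>T. ?rep (\<phi> k v))" for k
      have rep_\<phi>: "?rep (\<phi> k (?rep v)) = ?rep (\<phi> k v)" if "k \<in> carrier K" "v \<in> V" for k v
        using rep_cases[OF T, of v] rep_z[OF T] zk act that by metis
      have \<psi>_in: "\<psi> k v \<in> T" if "k \<in> carrier K" "v \<in> T" for k v
        using that T act rep_in[OF T] by (auto simp: \<psi>_def)
      have \<psi>_mult: "\<psi> (j \<otimes>\<^bsub>K\<^esub> k) v = \<psi> j (\<psi> k v)" if "j \<in> carrier K" "k \<in> carrier K" "v \<in> T" for j k v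
      proof -
        have "v \<in> V" using that T by blast
        then show ?thesis
          using that \<psi>_in[OF that(2,3)] rep_\<phi> act by (simp add: \<psi>_def composition_rule del: hom.hom_mult)
      qed
      have \<psi>_one: "\<psi> \<one>\<^bsub>K\<^esub> v = v" if "v \<in> T" for v
      proof -
        have "\<phi> \<one>\<^bsub>K\<^esub> v = v" using that T id_eq_one by (metis restrict_apply' subsetD)
        then show ?thesis using that by (simp add: \<psi>_def rep_def[OF T])
      qed
      have \<psi>_Bij: "\<psi> k \<in> Bij T" if k: "k \<in> carrier K" for k
      proof -
        have "bij_betw (\<psi> k) T T"
        proof (rule bij_betw_byWitness[where f' = "\<psi> (inv\<^bsub>K\<^esub> k)"])
          show "\<forall>v\<in>T. \<psi> (inv\<^bsub>K\<^esub> k) (\<psi> k v) = v" "\<forall>v\<in>T. \<psi> k (\<psi> (inv\<^bsub>K\<^esub> k) v) = v"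
            using k \<psi>_one by (simp_all add: \<psi>_mult[symmetric])
        qed (use k \<psi>_in in auto)
        then show ?thesis by (simp add: Bij_def \<psi>_def)
      qed
      have "\<psi> (j \<otimes>\<^bsub>K\<^esub> k) = compose T (\<psi> j) (\<psi> k)" if "j \<in> carrier K" "k \<in> carrier K" for j k
      proof (rule extensionalityI[of _ T])
        show "\<psi> (j \<otimes>\<^bsub>K\<^esub> k) v = compose T (\<psi> j) (\<psi> k) v" if "v \<in> T" for v
          using that \<open>j \<in> _\<close> \<open>k \<in> _\<close> by (simp add: \<psi>_mult compose_eq)
      qed (simp_all add: \<psi>_def compose_def)
      then have "\<psi> \<in> hom K (BijGroup T)"
        using \<psi>_Bij by (simp add: hom_def BijGroup_def)
      then have act': "group_action K T \<psi>"
        using hom.is_group group_BijGroup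
        by (simp add: group_action_def group_hom_def group_hom_axioms_def)
      have trans': "\<exists>k\<in>carrier K. \<psi> k u = v" if uv: "u \<in> T" "v \<in> T" for u v
      proof -
        obtain k where "k \<in> carrier K" "\<phi> k u = v" using trans uv T by blast
        then show ?thesis using uv by (auto simp: \<psi>_def rep_def[OF T])
      qed
      have inv': "?M (\<psi> k u) (\<psi> k v) = ?M u v" if k: "k \<in> carrier K" and uv: "u \<in> T" "v \<in> T" for k u v
      proof -
        have V: "u \<in> V" "v \<in> V" using uv T by auto
        have "?M (\<psi> k u) (\<psi> k v) = ?M (\<phi> k u) (\<phi> k v)"
          using quot_rep[OF T] act k V uv by (simp add: \<psi>_def)
        also have "\<dots> = m (\<phi> k u) (\<phi> k v) + m (\<phi> k u) (\<phi> k (z v))"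
          using zk k V by (simp add: quot_def)
        also have "\<dots> = ?M u v" using m_inv k V by (simp add: quot_def)
        finally show ?thesis .
      qed
      have deg': "(\<Sum>v\<in>T. ?M u v) = d" if "u \<in> T" for u
        using sum_transversal[OF T, of "m u"] less.prems(7) T that by (auto simp: quot_def)
      have "card V = card T + card T"
        using sum_transversal[OF T, of "\<lambda>_. 1 :: nat"] by (simp add: mult_2)
      moreover have "card V > 0" using False finite_V by (simp add: card_gt_0_iff)
      ultimately have "card T < card V" by simp
      have "\<exists>h. Z3_flow T ?M h"
      proof (rule less.hyps[OF \<open>card T < card V\<close> act' _ trans' _ _ inv' deg'])
        show "finite T" using T finite_V finite_subset by blast
        show "?M u v = ?M v u" if "u \<in> T" "v \<in> T" for u v
          using that T by (intro quot_sym) auto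
        show "?M v v = 0" if "v \<in> T" for v
          using that T fibre True by (auto simp: quot_def)
      qed
      then show ?thesis using Z3_flow_lift[OF T] fibre True by auto
    qed
  qed
qed

text \<open>Remove one element and subtract its sign from the target. The rest is constrained only
  if it has at most one element, and then one of the two signs leaves a feasible target.\<close>

lemma ex_signs_sum_mod_3:
  assumes "finite N" "card N = 0 \<Longrightarrow> 3 dvd t" "card N = 1 \<Longrightarrow> \<not> 3 dvd t"
  shows "\<exists>f :: 'e \<Rightarrow> int. (\<forall>e\<in>N. f e \<in> {1, - 1}) \<and> 3 dvd (\<Sum>e\<in>N. f e) - t"
  using assms
proof (induction N arbitrary: t)
  case empty
  then show ?case by simp
next
  case (insert a N)
  have "\<exists>x\<in>{1, - 1}. (card N = 0 \<longrightarrow> 3 dvd t - x) \<and> (card N = 1 \<longrightarrow> \<not> 3 dvd t - x)"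
  proof (cases "card N = 0")
    case True
    then have "\<not> 3 dvd t" using insert.hyps insert.prems(2) by simp
    then have "3 dvd t - 1 \<or> 3 dvd t - (-1)" by presburger
    then show ?thesis using True by auto
  next
    case False
    have "\<not> 3 dvd t - 1 \<or> \<not> 3 dvd t - (-1)" by presburger
    then show ?thesis using False by auto
  qed
  then obtain x where x: "x \<in> {1, - 1}" "card N = 0 \<longrightarrow> 3 dvd t - x" "card N = 1 \<longrightarrow> \<not> 3 dvd t - x"
    by (elim bexE conjE)
  obtain f where f: "\<forall>e\<in>N. f e \<in> {1, - 1}" "3 dvd (\<Sum>e\<in>N. f e) - (t - x)"
    using insert.IH[OF x(2,3)[rule_format]] by blast
  have "(\<Sum>e\<in>N. (f(a := x)) e) = (\<Sum>e\<in>N. f e)"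
    by (rule sum.cong) (use insert.hyps in auto)
  then show ?case
    using insert.hyps f x(1) by (intro exI[of _ "f(a := x)"]) (auto simp: algebra_simps)
qed


section \<open>Multigraphs\<close>

definition edge_mult :: "('v, 'e) multigraph \<Rightarrow> 'v \<Rightarrow> 'v \<Rightarrow> nat" where
  "edge_mult G u v = card {e \<in> edges G. ends G e = {u, v}}"

context finite_multigraph
begin

context
  assumes loopless: "loopless G"
begin

lemma loopless_ends: "e \<in> edges G \<Longrightarrow> ends G e \<noteq> {v}"
  using loopless by (auto simp: loopless_def)

lemma ends_pair: "e \<in> edges G \<Longrightarrow> \<exists>u v. u \<noteq> v \<and> ends G e = {u, v}"
  using card_ends loopless by (force simp: loopless_def card_2_iff)

text \<open>Without loops every edge at \<open>v\<close> has a unique other end, by which the edges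
  are grouped.\<close>

lemma sum_incident_edges:
  assumes v: "v \<in> vertices G"
  shows "(\<Sum>w\<in>vertices G. \<Sum>e\<in>{e \<in> edges G. ends G e = {v, w}}. f e) =
    (\<Sum>e\<in>{e \<in> edges G. v \<in> ends G e}. f e)"
proof -
  let ?S = "{e \<in> edges G. v \<in> ends G e}"
  define opp where "opp e = the_elem (ends G e - {v})" for e
  have opp: "ends G e = {v, opp e} \<and> opp e \<noteq> v" if e: "e \<in> ?S" for e
  proof -
    obtain a b where ab: "a \<noteq> b" "ends G e = {a, b}" using ends_pair[of e] e by auto
    then have "ends G e - {v} = {if v = a then b else a}" using e by auto
    then show ?thesis using ab e by (auto simp: opp_def)
  qed
  have "ends G e = {v, w} \<longleftrightarrow> v \<in> ends G e \<and> opp e = w" if "e \<in> edges G" for e w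
  proof (cases "v \<in> ends G e")
    case True
    then show ?thesis using opp[of e] that by (auto simp: doubleton_eq_iff)
  qed auto
  then have eq: "{e \<in> edges G. ends G e = {v, w}} = {e \<in> ?S. opp e = w}" for w
    by auto
  have "opp ` ?S \<subseteq> vertices G" using opp ends_subset by blast
  then show ?thesis
    unfolding eq using finite_edges finite_vertices by (intro sum.group) auto
qed

lemma card_incident_edges:
  assumes "has_valency G d" "v \<in> vertices G"
  shows "card {e \<in> edges G. v \<in> ends G e} = d"
proof -
  have "{e \<in> edges G. ends G e = {v}} = {}" using loopless_ends by blast
  then have "valency_at G v = card {e \<in> edges G. v \<in> ends G e}"
    unfolding valency_at_def by (simp only: card.empty add_0_right)
  then show ?thesis using assms by (simp add: has_valency_def)
qed

lemma sum_edge_mult: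
  assumes "has_valency G d" "v \<in> vertices G"
  shows "(\<Sum>w\<in>vertices G. edge_mult G v w) = d"
  using sum_incident_edges[OF assms(2), of "\<lambda>_. 1 :: nat"] card_incident_edges[OF assms]
  by (simp add: edge_mult_def)

text \<open>The direction is chosen per set of ends, so that parallel edges point the same way and
  their values simply add up.\<close>

lemma ex_orientation:
  "\<exists>D. orientation G D \<and> (\<forall>e\<in>edges G. tail D e \<noteq> head D e) \<and>
    (\<forall>e\<in>edges G. \<forall>e'\<in>edges G. ends G e = ends G e' \<longrightarrow> tail D e = tail D e' \<and> head D e = head D e')"
proof -
  have "\<forall>p\<in>ends G ` edges G. \<exists>uv. fst uv \<noteq> snd uv \<and> p = {fst uv, snd uv}"
    using ends_pair by fastforce
  then obtain f where f: "\<And>p. p \<in> ends G ` edges G \<Longrightarrow> fst (f p) \<noteq> snd (f p) \<and> p = {fst (f p), snd (f p)}"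
    by metis
  define D where "D = \<lparr>verts = vertices G, arcs = edges G,
    tail = \<lambda>e. fst (f (ends G e)), head = \<lambda>e. snd (f (ends G e))\<rparr>"
  have "orientation G D"
    using f by (simp add: orientation_def D_def)
  then show ?thesis using f by (intro exI[of _ D]) (simp add: D_def)
qed

lemma net_flow_incident:
  assumes D: "orientation G D"
  shows "net_flow D \<phi> v = (\<Sum>e\<in>{e \<in> edges G. v \<in> ends G e}.
    \<phi> e * (of_bool (tail D e = v) - of_bool (head D e = v)))"
  unfolding net_flow_def
  by (rule sum.mono_neutral_right) (use D finite_edges in \<open>auto simp: orientation_def\<close>)

lemma admits_flow_even_valency:
  assumes "has_valency G d" "even d"
  shows "admits_nowhere_zero_flow G 3"
proof -
  obtain D where D: "orientation G D" "\<forall>e\<in>edges G. tail D e \<noteq> head D e"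
    using ex_orientation by blast
  have "modular_flow D (int 2) (\<lambda>_. 1)"
    unfolding modular_flow_def
  proof (intro conjI ballI)
    fix v assume "v \<in> verts D"
    then have v: "v \<in> vertices G" using D by (simp add: orientation_def)
    let ?S = "{e \<in> edges G. v \<in> ends G e}"
    have S: "even (card ?S)" using card_incident_edges[OF assms(1) v] assms(2) by simp
    \<comment> \<open>Each edge at \<open>v\<close> contributes 1 or -1, so the imbalance has the
      parity of the valency.\<close>
    have "net_flow D (\<lambda>_. 1) v - int (card ?S) =
        (\<Sum>e\<in>?S. of_bool (tail D e = v) - of_bool (head D e = v) - 1)"
      by (simp add: net_flow_incident[OF D(1)] sum_subtractf)
    also have "even \<dots>"
      by (rule dvd_sum) (use D in \<open>auto simp: orientation_def\<close>)
    finally have "even (net_flow D (\<lambda>_. 1) v - int (card ?S))" .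
    then show "int 2 dvd net_flow D (\<lambda>_. 1) v" using S by simp
  qed auto
  then show ?thesis
    by (rule admits_nowhere_zero_flow_if_modular_flow[OF finite_multigraph_axioms D(1)]) simp
qed

lemma admits_flow_if_Z3_flow:
  assumes "Z3_flow (vertices G) (edge_mult G) g"
  shows "admits_nowhere_zero_flow G 3"
proof -
  let ?V = "vertices G"
  obtain D where D: "orientation G D" "\<forall>e\<in>edges G. tail D e \<noteq> head D e"
    "\<And>e e'. e \<in> edges G \<Longrightarrow> e' \<in> edges G \<Longrightarrow> ends G e = ends G e' \<Longrightarrow>
      tail D e = tail D e' \<and> head D e = head D e'"
    using ex_orientation by blast
  have ends: "ends G e = {tail D e, head D e}" "tail D e \<in> ?V" "head D e \<in> ?V" if "e \<in> edges G" for e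
    using D(1) ends_subset[OF that] that by (auto simp: orientation_def)
  define E where "E e = {e' \<in> edges G. ends G e' = ends G e}" for e
  have ex: "\<exists>f :: 'e \<Rightarrow> int. (\<forall>e'\<in>E e. f e' \<in> {1, - 1}) \<and> 3 dvd (\<Sum>e'\<in>E e. f e') - g (tail D e) (head D e)"
    if e: "e \<in> edges G" for e
  proof (rule ex_signs_sum_mod_3)
    have card: "card (E e) = edge_mult G (tail D e) (head D e)"
      using ends(1)[OF e] by (simp add: E_def edge_mult_def)
    have "edge_mult G (tail D e) (head D e) = 0 \<longrightarrow> g (tail D e) (head D e) = 0"
      "edge_mult G (tail D e) (head D e) = 1 \<longrightarrow> \<not> 3 dvd g (tail D e) (head D e)"
      using assms ends(2,3)[OF e] unfolding Z3_flow_def admissible_def by blast+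
    then show "card (E e) = 0 \<Longrightarrow> 3 dvd g (tail D e) (head D e)"
      "card (E e) = 1 \<Longrightarrow> \<not> 3 dvd g (tail D e) (head D e)"
      unfolding card by simp_all
  qed (simp add: E_def finite_edges)
  \<comment> \<open>The signs are chosen once per set of ends, so that parallel edges draw theirs
    from one common function.\<close>
  have "\<forall>p\<in>ends G ` edges G. \<exists>f :: 'e \<Rightarrow> int. \<forall>e\<in>edges G. ends G e = p \<longrightarrow>
      (\<forall>e'\<in>E e. f e' \<in> {1, - 1}) \<and> 3 dvd (\<Sum>e'\<in>E e. f e') - g (tail D e) (head D e)"
  proof (intro ballI, elim imageE)
    fix p e0 assume e0: "p = ends G e0" "e0 \<in> edges G"
    have "E e = E e0 \<and> tail D e = tail D e0 \<and> head D e = head D e0"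
      if "e \<in> edges G" "ends G e = p" for e
      using D(3)[OF that(1) e0(2)] that(2) e0(1) by (simp add: E_def)
    then show "\<exists>f :: 'e \<Rightarrow> int. \<forall>e\<in>edges G. ends G e = p \<longrightarrow>
      (\<forall>e'\<in>E e. f e' \<in> {1, - 1}) \<and> 3 dvd (\<Sum>e'\<in>E e. f e') - g (tail D e) (head D e)"
      using ex[OF e0(2)] by metis
  qed
  then obtain F :: "'v set \<Rightarrow> 'e \<Rightarrow> int" where F: "\<And>e e'. e \<in> edges G \<Longrightarrow> e' \<in> E e \<Longrightarrow> F (ends G e) e' \<in> {1, - 1}"
    "\<And>e. e \<in> edges G \<Longrightarrow> 3 dvd (\<Sum>e'\<in>E e. F (ends G e) e') - g (tail D e) (head D e)"
    by (metis (no_types, lifting) imageI)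
  define \<phi> where "\<phi> e = F (ends G e) e" for e
  have \<phi>: "\<phi> e \<in> {1, - 1}" if "e \<in> edges G" for e
    using F(1)[OF that, of e] that by (simp add: \<phi>_def E_def)
  have \<phi>_sum: "3 dvd (\<Sum>e'\<in>E e. \<phi> e') - g (tail D e) (head D e)" if "e \<in> edges G" for e
  proof -
    have "(\<Sum>e'\<in>E e. \<phi> e') = (\<Sum>e'\<in>E e. F (ends G e) e')"
      by (rule sum.cong) (auto simp: \<phi>_def E_def)
    then show ?thesis using F(2)[OF that] by simp
  qed
  have "modular_flow D (int 3) \<phi>"
    unfolding modular_flow_def
  proof (intro conjI ballI)
    fix e assume "e \<in> arcs D"
    then have "\<phi> e \<in> {1, - 1}" using \<phi> D(1) by (simp add: orientation_def)
    then show "0 < \<bar>\<phi> e\<bar>" "\<bar>\<phi> e\<bar> < int 3" by auto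
  next
    fix v assume "v \<in> verts D"
    then have v: "v \<in> ?V" using D(1) by (simp add: orientation_def)
    have g: "g w v = - g v w" "edge_mult G v w = 0 \<Longrightarrow> g v w = 0" if "w \<in> ?V" for w
      using assms v that unfolding Z3_flow_def admissible_def by blast+
    let ?E = "\<lambda>w. {e \<in> edges G. ends G e = {v, w}}"
    let ?s = "\<lambda>e. of_bool (tail D e = v) - of_bool (head D e = v)"
    have "3 dvd (\<Sum>e\<in>?E w. \<phi> e * ?s e) - g v w" if w: "w \<in> ?V" for w
    proof (cases "?E w = {}")
      case True
      then have "g v w = 0" using g(2)[OF w] unfolding edge_mult_def by (simp only: card.empty)
      then show ?thesis unfolding True by simp
    next
      case False
      then obtain e where e: "e \<in> edges G" "ends G e = {v, w}" by blast
      have Ee: "?E w = E e" using e by (simp add: E_def)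
      have "(\<Sum>e'\<in>?E w. \<phi> e' * ?s e') = (\<Sum>e'\<in>E e. \<phi> e' * ?s e)"
        unfolding Ee
      proof (rule sum.cong[OF refl])
        fix e' assume "e' \<in> E e"
        then have "tail D e' = tail D e \<and> head D e' = head D e"
          by (intro D(3)) (simp_all add: E_def e(1))
        then show "\<phi> e' * ?s e' = \<phi> e' * ?s e" by simp
      qed
      then have sum: "(\<Sum>e'\<in>?E w. \<phi> e' * ?s e') = (\<Sum>e'\<in>E e. \<phi> e') * ?s e"
        by (simp add: sum_distrib_right)
      have "tail D e = v \<and> head D e = w \<or> tail D e = w \<and> head D e = v"
        using ends(1)[OF e(1)] e(2) by (auto simp: doubleton_eq_iff)
      moreover have "v \<noteq> w" using loopless_ends e by auto
      ultimately show ?thesis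
        using \<phi>_sum[OF e(1)] g(1)[OF w] sum by auto (presburger)
    qed
    then have "3 dvd (\<Sum>w\<in>?V. (\<Sum>e\<in>?E w. \<phi> e * ?s e) - g v w)" by (rule dvd_sum)
    then have "3 dvd net_flow D \<phi> v - (\<Sum>w\<in>?V. g v w)"
      by (simp add: sum_subtractf sum_incident_edges[OF v] net_flow_incident[OF D(1)])
    moreover have "3 dvd (\<Sum>w\<in>?V. g v w)" using assms v by (simp add: Z3_flow_def)
    ultimately show "int 3 dvd net_flow D \<phi> v" by (metis dvd_add diff_add_cancel of_nat_numeral)
  qed
  then show ?thesis
    by (rule admits_nowhere_zero_flow_if_modular_flow[OF finite_multigraph_axioms D(1)]) simp
qed

end

section \<open>The action of automorphisms on vertices\<close>

definition vertex_action :: "('v + 'e \<Rightarrow> 'v + 'e) \<Rightarrow> 'v \<Rightarrow> 'v" where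
  "vertex_action f = (\<lambda>v\<in>vertices G. projl (f (Inl v)))"

lemma automorphism_Inl:
  assumes "f \<in> automorphisms G" "v \<in> vertices G"
  shows "f (Inl v) = Inl (vertex_action f v)" "vertex_action f v \<in> vertices G"
proof -
  have "f ` Inl ` vertices G = Inl ` vertices G" using assms(1) by (simp add: automorphisms_def)
  then have "f (Inl v) \<in> Inl ` vertices G" using assms(2) by blast
  then show "f (Inl v) = Inl (vertex_action f v)" "vertex_action f v \<in> vertices G"
    using assms(2) by (auto simp: vertex_action_def)
qed

lemma bij_betw_vertex_action:
  assumes f: "f \<in> automorphisms G"
  shows "bij_betw (vertex_action f) (vertices G) (vertices G)"
proof -
  have inj: "inj_on f (vertices G <+> edges G)"
    using f by (simp add: automorphisms_def Bij_def bij_betw_def)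
  have "inj_on (vertex_action f) (vertices G)"
  proof (rule inj_onI)
    fix u v assume "u \<in> vertices G" "v \<in> vertices G" "vertex_action f u = vertex_action f v"
    then show "u = v"
      using automorphism_Inl(1)[OF f] inj_onD[OF inj, of "Inl u" "Inl v"] by (simp add: InlI)
  qed
  moreover have "vertex_action f ` vertices G \<subseteq> vertices G" using automorphism_Inl(2)[OF f] by blast
  ultimately show ?thesis
    using finite_vertices by (simp add: bij_betw_def endo_inj_surj)
qed

text \<open>The automorphism also permutes the edges, by \<open>q\<close>, and preservation of
  incidence makes \<open>q\<close> map one parallel class bijectively onto the other.\<close>

lemma vertex_action_edge_mult:
  assumes f: "f \<in> automorphisms G" and uv: "u \<in> vertices G" "v \<in> vertices G"
  shows "edge_mult G (vertex_action f u) (vertex_action f v) = edge_mult G u v"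
proof -
  let ?p = "vertex_action f" and ?V = "vertices G"
  define q where "q e = projr (f (Inr e))" for e
  have q: "f (Inr e) = Inr (q e)" "q e \<in> edges G" if "e \<in> edges G" for e
  proof -
    have "f ` Inr ` edges G = Inr ` edges G" using f by (simp add: automorphisms_def)
    then have "f (Inr e) \<in> Inr ` edges G" using that by blast
    then show "f (Inr e) = Inr (q e)" "q e \<in> edges G" by (auto simp: q_def)
  qed
  have inj: "inj_on f (?V <+> edges G)"
    using f by (simp add: automorphisms_def Bij_def bij_betw_def)
  have inj_q: "inj_on q (edges G)"
  proof (rule inj_onI)
    fix a b assume "a \<in> edges G" "b \<in> edges G" "q a = q b"
    then show "a = b" using q(1) inj_onD[OF inj, of "Inr a" "Inr b"] by (simp add: InrI)
  qed
  have q_img: "q ` edges G = edges G"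
    using finite_edges inj_q q(2) by (simp add: endo_inj_surj image_subsetI)
  have p: "inj_on ?p ?V" "?p ` ?V = ?V"
    using bij_betw_vertex_action[OF f] by (auto simp: bij_betw_def)
  have ends_q: "ends G (q e) = ?p ` ends G e" if e: "e \<in> edges G" for e
  proof -
    have inc: "w \<in> ends G e \<longleftrightarrow> ?p w \<in> ends G (q e)" if "w \<in> ?V" for w
      using f automorphism_Inl(1)[OF f that] q(1)[OF e] that e unfolding automorphisms_def by blast
    have "ends G (q e) \<subseteq> ?p ` ?V" using ends_subset[OF q(2)[OF e]] p(2) by simp
    then show ?thesis using inc ends_subset[OF e] by blast
  qed
  have "ends G (q e) = {?p u, ?p v} \<longleftrightarrow> ends G e = {u, v}" if e: "e \<in> edges G" for e
    using inj_on_image_eq_iff[OF p(1) ends_subset[OF e], of "{u, v}"] uv by (simp add: ends_q[OF e])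
  then have "{e \<in> edges G. ends G e = {?p u, ?p v}} = q ` {e \<in> edges G. ends G e = {u, v}}"
    using q_img by (auto simp: image_iff) (metis imageE)
  moreover have "inj_on q {e \<in> edges G. ends G e = {u, v}}"
    using inj_q by (rule inj_on_subset) auto
  ultimately show ?thesis by (simp add: edge_mult_def card_image)
qed

lemma vertex_action_group_action:
  assumes "group ((Aut G)\<lparr>carrier := H\<rparr>)" "H \<subseteq> automorphisms G"
  shows "group_action ((Aut G)\<lparr>carrier := H\<rparr>) (vertices G) vertex_action"
proof -
  have H: "f \<in> automorphisms G" if "f \<in> H" for f
    using assms(2) that by blast
  have B: "vertex_action f \<in> Bij (vertices G)" if "f \<in> H" for f
    using bij_betw_vertex_action[OF H[OF that]] by (simp add: Bij_def vertex_action_def)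
  have "vertex_action (f \<otimes>\<^bsub>Aut G\<^esub> g) = compose (vertices G) (vertex_action f) (vertex_action g)"
    if "f \<in> H" "g \<in> H" for f g
  proof (rule extensionalityI[of _ "vertices G"])
    fix v assume v: "v \<in> vertices G"
    have "f \<in> Bij (vertices G <+> edges G)" "g \<in> Bij (vertices G <+> edges G)"
      using H that by (auto simp: automorphisms_def)
    then have "(f \<otimes>\<^bsub>Aut G\<^esub> g) (Inl v) = f (g (Inl v))"
      using v by (simp add: Aut_def BijGroup_def compose_eq InlI)
    then show "vertex_action (f \<otimes>\<^bsub>Aut G\<^esub> g) v = compose (vertices G) (vertex_action f) (vertex_action g) v"
      using v automorphism_Inl(1)[OF H[OF that(2)] v] automorphism_Inl(2)[OF H[OF that(2)] v]
        automorphism_Inl(1)[OF H[OF that(1)], of "vertex_action g v"]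
      by (simp add: compose_eq vertex_action_def[of "f \<otimes>\<^bsub>Aut G\<^esub> g"])
  qed (simp_all add: vertex_action_def compose_def)
  then have "vertex_action \<in> hom ((Aut G)\<lparr>carrier := H\<rparr>) (BijGroup (vertices G))"
    using B by (simp add: hom_def BijGroup_def)
  then show ?thesis
    using assms(1) group_BijGroup
    by (simp add: group_action_def group_hom_def group_hom_axioms_def)
qed

lemma admits_flow_odd_valency:
  assumes "nilpotently_vertex_transitive G" "has_valency G d" "odd d" "d \<ge> 4"
  shows "admits_nowhere_zero_flow G 3"
proof -
  obtain H where H: "loopless G" "subgroup H (Aut G)" "nilpotent_group ((Aut G)\<lparr>carrier := H\<rparr>)"
    "transitive_on_vertices G H"
    using assms(1) unfolding nilpotently_vertex_transitive_def by blast
  have aut: "H \<subseteq> automorphisms G"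
    using subgroup.subset[OF H(2)] by (simp add: Aut_def)
  note action = vertex_action_group_action[OF nilpotent_group.axioms(1)[OF H(3)] aut]
  have "\<exists>g. Z3_flow (vertices G) (edge_mult G) g"
  proof (rule ex_Z3_flow_nilpotent[OF H(3) assms(3,4) action finite_vertices])
    fix u v assume uv: "u \<in> vertices G" "v \<in> vertices G"
    then obtain f where f: "f \<in> H" "f (Inl u) = Inl v"
      using H(4) unfolding transitive_on_vertices_def by blast
    then have "vertex_action f u = v" using uv by (simp add: vertex_action_def)
    then show "\<exists>k\<in>carrier ((Aut G)\<lparr>carrier := H\<rparr>). vertex_action k u = v" using f by auto
    show "edge_mult G u v = edge_mult G v u" by (simp add: edge_mult_def insert_commute)
    show "edge_mult G (vertex_action k u) (vertex_action k v) = edge_mult G u v"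
      if "k \<in> carrier ((Aut G)\<lparr>carrier := H\<rparr>)" for k
      using vertex_action_edge_mult[OF subsetD[OF aut] uv] that by simp
  next
    fix v assume "v \<in> vertices G"
    then show "(\<Sum>w\<in>vertices G. edge_mult G v w) = d" by (rule sum_edge_mult[OF H(1) assms(2)])
    have "{e \<in> edges G. ends G e = {v, v}} = {}" using loopless_ends[OF H(1)] by auto
    then show "edge_mult G v v = 0" unfolding edge_mult_def by (simp only: card.empty)
  qed
  then show ?thesis using admits_flow_if_Z3_flow[OF H(1)] by blast
qed

end

theorem theorem1p1:
  fixes G :: "('v, 'e) multigraph" and d :: nat
  assumes "finite_multigraph G"
    and "nilpotently_vertex_transitive G"
    and "has_valency G d"
    and "d \<ge> 4"
  shows "admits_nowhere_zero_flow G 3"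
  using finite_multigraph.admits_flow_even_valency[OF assms(1) _ assms(3)]
    finite_multigraph.admits_flow_odd_valency[OF assms(1-3) _ assms(4)] assms(2)
  unfolding nilpotently_vertex_transitive_def by blast

end
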